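(* Let $\mathbb{K}=\mathbb{C}$ or $\mathbb{H}$. For any $n\geq 1$, the configuration space $\mathcal{C}_2(\mathbb{K}P^n)$ is homeomorphic to $D_o(\theta_n)$, and homotopy equivalent to $\varGamma_n$.
   Context: $\mathcal{C}_2(X)$ is the configuration space of unordered pairs of distinct points of $X$, i.e. $SP^2(X)\setminus\varDelta$ where $SP^2(X)=(X\times X)/C_2$ and $\varDelta$ is the diagonal. Let $d=\dim_{\mathbb{R}}\mathbb{K}\in\{2,4\}$; scalars act on the right of $\mathbb{K}^{n+1}$, which carries the Hermitian inner product $u^\star v=\sum\bar u_iv_i$. $P^d$ is the group of matrices $\begin{pmatrix}a&0\\ 0&b\end{pmatrix}$, $\begin{pmatrix}0&a\\ b&0\end{pmatrix}$ with $a,b$ in the unit sphere $S^{d-1}\subset\mathbb{K}$, and $\tau=\begin{pmatrix}0&1\\ 1&0\end{pmatrix}$. $V_{n+1,2}$ is the Stiefel manifold of orthonormal $2$-frames $(u\;v)$ in $\mathbb{K}^{n+1}$, with right $P^d$-action by matrix multiplication; $\varGamma_n=V_{n+1,2}/P^d$ is the space of unordered pairs of orthogonal lines in $\mathbb{K}^{n+1}$. $P^d$ acts on the left of $\mathbb{K}$ by $\tau\cdot k=\bar k$ and $\begin{pmatrix}a&0\\ 0&b\end{pmatrix}\cdot k=ak\bar b$; $\theta_n$ is the real $d$-plane bundle $V_{n+1,2}\times_{P^d}\mathbb{K}\to\varGamma_n$, and $D_o(\theta_n)=V_{n+1,2}\times_{P^d}\{k\in\mathbb{K}:|k|<1\}$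 is the total space of its open unit disc bundle. *)

theory Defs
  imports "HOL-Analysis.Analysis"
begin

section \<open>Quaternions\<close>

text \<open>The quaternion with components \<open>a, b, c, d\<close> is \<open>a + b i + c j + d k\<close>.\<close>

codatatype quat = Quat (qRe: real) (qI: real) (qJ: real) (qK: real)

lemma quat_eq_iff: "x = y \<longleftrightarrow> qRe x = qRe y \<and> qI x = qI y \<and> qJ x = qJ y \<and> qK x = qK y"
  by (auto intro: quat.expand)

instantiation quat :: ab_group_add
begin

primcorec zero_quat where
  "qRe 0 = 0" | "qI 0 = 0" | "qJ 0 = 0" | "qK 0 = 0"

primcorec plus_quat where
  "qRe (x + y) = qRe x + qRe y"
| "qI (x + y) = qI x + qI y"
| "qJ (x + y) = qJ x + qJ y"
| "qK (x + y) = qK x + qK y"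

primcorec uminus_quat where
  "qRe (- x) = - qRe x" | "qI (- x) = - qI x" | "qJ (- x) = - qJ x" | "qK (- x) = - qK x"

primcorec minus_quat where
  "qRe (x - y) = qRe x - qRe y"
| "qI (x - y) = qI x - qI y"
| "qJ (x - y) = qJ x - qJ y"
| "qK (x - y) = qK x - qK y"

instance
  by standard (simp_all add: quat_eq_iff)

end

instantiation quat :: ring_1
begin

primcorec one_quat where
  "qRe 1 = 1" | "qI 1 = 0" | "qJ 1 = 0" | "qK 1 = 0"

primcorec times_quat where
  "qRe (x * y) = qRe x * qRe y - qI x * qI y - qJ x * qJ y - qK x * qK y"
| "qI (x * y) = qRe x * qI y + qI x * qRe y + qJ x * qK y - qK x * qJ y"
| "qJ (x * y) = qRe x * qJ y - qI x * qK y + qJ x * qRe y + qK x * qI y"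
| "qK (x * y) = qRe x * qK y + qI x * qJ y - qJ x * qI y + qK x * qRe y"

instance
  by standard (simp_all add: quat_eq_iff algebra_simps)

end

instantiation quat :: real_algebra_1
begin

primcorec scaleR_quat where
  "qRe (r *\<^sub>R x) = r * qRe x"
| "qI (r *\<^sub>R x) = r * qI x"
| "qJ (r *\<^sub>R x) = r * qJ x"
| "qK (r *\<^sub>R x) = r * qK x"

instance
  by standard (simp_all add: quat_eq_iff algebra_simps)

end

instantiation quat :: real_inner
begin

definition inner_quat_def:
  "inner x y = qRe x * qRe y + qI x * qI y + qJ x * qJ y + qK x * qK y" for x y :: quat

definition norm_quat_def: "norm x = sqrt (inner x x)" for x :: quat

definition sgn_quat_def: "sgn x = x /\<^sub>R norm x" for x :: quat

definition dist_quat_def: "dist x y = norm (x - y)" for x y :: quat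

definition uniformity_quat_def [code del]:
  "(uniformity :: (quat \<times> quat) filter) = (INF e\<in>{0 <..}. principal {(x, y). dist x y < e})"

definition open_quat_def [code del]:
  "open U \<longleftrightarrow> (\<forall>x\<in>U. eventually (\<lambda>(x', y). x' = x \<longrightarrow> y \<in> U) uniformity)" for U :: "quat set"

instance
proof
  fix x y z :: quat and r :: real
  show "inner x y = inner y x"
    by (simp add: inner_quat_def mult.commute)
  show "inner (x + y) z = inner x z + inner y z"
    by (simp add: inner_quat_def algebra_simps)
  show "inner (r *\<^sub>R x) y = r * inner x y"
    by (simp add: inner_quat_def algebra_simps)
  show "0 \<le> inner x x"
    by (simp add: inner_quat_def)
  show "inner x x = 0 \<longleftrightarrow> x = 0"
    by (simp add: inner_quat_def quat_eq_iff add_nonneg_eq_0_iff)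
qed (rule norm_quat_def sgn_quat_def dist_quat_def uniformity_quat_def open_quat_def)+

end

lemma norm_quat_sq: "(norm x)\<^sup>2 = (qRe x)\<^sup>2 + (qI x)\<^sup>2 + (qJ x)\<^sup>2 + (qK x)\<^sup>2" for x :: quat
  unfolding power2_norm_eq_inner by (simp add: inner_quat_def power2_eq_square)

instantiation quat :: euclidean_space
begin

definition Basis_quat_def:
  "Basis = {Quat 1 0 0 0, Quat 0 1 0 0, Quat 0 0 1 0, Quat 0 0 0 1}"

instance
proof
  fix u v x :: quat
  show "inner u v = (if u = v then 1 else 0)" if "u \<in> Basis" "v \<in> Basis"
    using that unfolding Basis_quat_def by (elim insertE emptyE) (simp_all add: inner_quat_def)
  show "(\<forall>u\<in>Basis. inner x u = 0) \<longleftrightarrow> x = 0"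
    unfolding Basis_quat_def quat_eq_iff[of x] by (simp add: inner_quat_def)
qed (simp_all add: Basis_quat_def)

end

primcorec qcnj :: "quat \<Rightarrow> quat" where
  "qRe (qcnj x) = qRe x"
| "qI (qcnj x) = - qI x"
| "qJ (qcnj x) = - qJ x"
| "qK (qcnj x) = - qK x"

lemma quat_of_real_sel [simp]:
  "qRe (of_real r) = r" "qI (of_real r) = 0" "qJ (of_real r) = 0" "qK (of_real r) = 0"
  by (simp_all add: of_real_def)

lemma qcnj_mult_self: "qcnj x * x = of_real ((norm x)\<^sup>2)" "x * qcnj x = of_real ((norm x)\<^sup>2)"
  unfolding norm_quat_sq by (simp_all add: quat_eq_iff power2_eq_square algebra_simps)

lemma euler_four_square:
  fixes a b c d e f g h :: real
  shows "(a * e - b * f - c * g - d * h)\<^sup>2 + (a * f + b * e + c * h - d * g)\<^sup>2 +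
         (a * g - b * h + c * e + d * f)\<^sup>2 + (a * h + b * g - c * f + d * e)\<^sup>2 =
         (a\<^sup>2 + b\<^sup>2 + c\<^sup>2 + d\<^sup>2) * (e\<^sup>2 + f\<^sup>2 + g\<^sup>2 + h\<^sup>2)"
  by algebra

instantiation quat :: real_normed_div_algebra
begin

definition inverse_quat_def: "inverse x = qcnj x /\<^sub>R (norm x)\<^sup>2" for x :: quat

definition divide_quat_def: "x div y = x * inverse y" for x y :: quat

instance
proof
  fix x y :: quat
  show "inverse x * x = 1" if "x \<noteq> 0"
    unfolding inverse_quat_def mult_scaleR_left qcnj_mult_self unfolding of_real_def
    using that by simp
  show "x * inverse x = 1" if "x \<noteq> 0"
    unfolding inverse_quat_def mult_scaleR_right qcnj_mult_self unfolding of_real_def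
    using that by simp
  show "x div y = x * inverse y"
    by (rule divide_quat_def)
  show "inverse (0 :: quat) = 0"
    by (simp add: inverse_quat_def)
  have "(norm (x * y))\<^sup>2 = (norm x * norm y)\<^sup>2"
    unfolding power_mult_distrib norm_quat_sq times_quat.sel by (rule euler_four_square)
  then show "norm (x * y) = norm x * norm y"
    by (rule power2_eq_imp_eq) simp_all
qed

end


section \<open>Normed division algebras with conjugation\<close>

class conj_div_algebra = real_normed_div_algebra +
  fixes hconj :: "'a \<Rightarrow> 'a"
  assumes hconj_add: "hconj (x + y) = hconj x + hconj y"
    and hconj_scaleR: "hconj (r *\<^sub>R x) = r *\<^sub>R hconj x"
    and hconj_mult: "hconj (x * y) = hconj y * hconj x"
    and hconj_hconj [simp]: "hconj (hconj x) = x"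
    and hconj_mult_self: "hconj x * x = (norm x)\<^sup>2 *\<^sub>R 1"

instantiation complex :: conj_div_algebra
begin

definition hconj_complex_def: "hconj = cnj"

instance
proof
  fix x y :: complex and r :: real
  show "hconj x * x = (norm x)\<^sup>2 *\<^sub>R 1"
    unfolding hconj_complex_def by (metis complex_norm_square mult.commute of_real_def)
qed (simp_all add: hconj_complex_def)

end

instantiation quat :: conj_div_algebra
begin

definition hconj_quat_def: "hconj = qcnj"

instance
proof
  fix x y :: quat and r :: real
  show "hconj x * x = (norm x)\<^sup>2 *\<^sub>R 1"
    unfolding hconj_quat_def qcnj_mult_self of_real_def by (rule refl)
qed (simp_all add: hconj_quat_def quat_eq_iff)

end

lemma hconj_0 [simp]: "hconj 0 = (0 :: 'k::conj_div_algebra)"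
  using hconj_scaleR[of 0 "0 :: 'k"] by simp

lemma hconj_1 [simp]: "hconj 1 = (1 :: 'k::conj_div_algebra)"
  using hconj_mult_self[of "1 :: 'k"] by simp

lemma norm_hconj [simp]: "norm (hconj x) = norm x" for x :: "'k::conj_div_algebra"
proof (cases "x = 0")
  case False
  have "norm (hconj x) * norm x = norm x * norm x"
    using arg_cong[OF hconj_mult_self[of x], of norm]
    by (simp only: norm_mult norm_scaleR norm_one) (simp add: power2_eq_square)
  with False show ?thesis by simp
qed simp

lemma hconj_mult_unit:
  fixes a :: "'k::conj_div_algebra"
  assumes "norm a = 1"
  shows "hconj a * a = 1" "a * hconj a = 1"
  using hconj_mult_self[of a] hconj_mult_self[of "hconj a"] assms by simp_all


section \<open>Quotient spaces and configuration spaces\<close>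

text \<open>The points are the classes \<open>r `` {x}\<close>; the topology is the finest one making
  \<open>x \<mapsto> r `` {x}\<close> continuous. It is only used for equivalence relations \<open>r\<close> on \<open>topspace X\<close>.\<close>

definition quotient_space :: "'a topology \<Rightarrow> ('a \<times> 'a) set \<Rightarrow> 'a set topology" where
  "quotient_space X r =
     topology (\<lambda>U. U \<subseteq> topspace X // r \<and> openin X {x \<in> topspace X. r `` {x} \<in> U})"

lemma openin_quotient_space:
  "openin (quotient_space X r) U \<longleftrightarrow>
     U \<subseteq> topspace X // r \<and> openin X {x \<in> topspace X. r `` {x} \<in> U}"
proof -
  have "istopology (\<lambda>U. U \<subseteq> topspace X // r \<and> openin X {x \<in> topspace X. r `` {x} \<in> U})"
    unfolding istopology_def
  proof (intro conjI allI impI)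
    fix S T
    assume S: "S \<subseteq> topspace X // r \<and> openin X {x \<in> topspace X. r `` {x} \<in> S}"
      and T: "T \<subseteq> topspace X // r \<and> openin X {x \<in> topspace X. r `` {x} \<in> T}"
    then show "S \<inter> T \<subseteq> topspace X // r" by blast
    have "{x \<in> topspace X. r `` {x} \<in> S \<inter> T} =
        {x \<in> topspace X. r `` {x} \<in> S} \<inter> {x \<in> topspace X. r `` {x} \<in> T}" by blast
    with S T show "openin X {x \<in> topspace X. r `` {x} \<in> S \<inter> T}" by auto
  next
    fix \<K>
    assume K: "\<forall>S\<in>\<K>. S \<subseteq> topspace X // r \<and> openin X {x \<in> topspace X. r `` {x} \<in> S}"
    then show "\<Union>\<K> \<subseteq> topspace X // r" by blast
    have "{x \<in> topspace X. r `` {x} \<in> \<Union>\<K>} = (\<Union>S\<in>\<K>. {x \<in> topspace X. r `` {x} \<in> S})" by blast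
    with K show "openin X {x \<in> topspace X. r `` {x} \<in> \<Union>\<K>}" by auto
  qed
  then show ?thesis by (simp add: quotient_space_def)
qed

lemma topspace_quotient_space: "topspace (quotient_space X r) = topspace X // r"
proof (rule antisym)
  show "topspace (quotient_space X r) \<subseteq> topspace X // r"
    using openin_quotient_space openin_topspace by blast
  have "{x \<in> topspace X. r `` {x} \<in> topspace X // r} = topspace X"
    by (auto simp: quotient_def)
  then have "openin (quotient_space X r) (topspace X // r)"
    by (simp add: openin_quotient_space)
  then show "topspace X // r \<subseteq> topspace (quotient_space X r)"
    by (rule openin_subset)
qed

lemma quotient_map_quotient_space: "quotient_map X (quotient_space X r) (\<lambda>x. r `` {x})"
  unfolding quotient_map_def
  by (auto simp: topspace_quotient_space openin_quotient_space quotient_def)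

definition swap_rel :: "'a set \<Rightarrow> (('a \<times> 'a) \<times> ('a \<times> 'a)) set" where
  "swap_rel S = {(p, q). p \<in> S \<times> S \<and> (q = p \<or> q = prod.swap p)}"

lemma equiv_swap_rel: "equiv (S \<times> S) (swap_rel S)"
  by (auto simp: swap_rel_def intro!: equivI refl_onI symI transI)

definition SP2 :: "'a topology \<Rightarrow> ('a \<times> 'a) set topology" where
  "SP2 X = quotient_space (prod_topology X X) (swap_rel (topspace X))"

definition SP2_diagonal :: "'a topology \<Rightarrow> ('a \<times> 'a) set set" where
  "SP2_diagonal X = (\<lambda>x. swap_rel (topspace X) `` {(x, x)}) ` topspace X"

definition conf2 :: "'a topology \<Rightarrow> ('a \<times> 'a) set topology" where
  "conf2 X = subtopology (SP2 X) (topspace (SP2 X) - SP2_diagonal X)"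


section \<open>Projective space\<close>

definition rscale :: "'k::times ^ 'm \<Rightarrow> 'k \<Rightarrow> 'k ^ 'm" where
  "rscale u c = (\<chi> i. u $ i * c)"

definition line_rel :: "(('k::conj_div_algebra ^ 'm) \<times> ('k ^ 'm)) set" where
  "line_rel = {(u, v). u \<noteq> 0 \<and> (\<exists>c. c \<noteq> 0 \<and> v = rscale u c)}"

lemma rscale_rscale: "rscale (rscale u c) d = rscale u (c * d)" for u :: "'k::conj_div_algebra ^ 'm"
  by (simp add: rscale_def mult.assoc)

lemma rscale_1: "rscale u 1 = u" for u :: "'k::conj_div_algebra ^ 'm"
  by (simp add: rscale_def)

lemma rscale_eq_0_iff: "rscale u c = 0 \<longleftrightarrow> u = 0 \<or> c = 0" for u :: "'k::conj_div_algebra ^ 'm"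
  by (auto simp: rscale_def vec_eq_iff)

lemma equiv_line_rel: "equiv (- {0}) (line_rel :: (('k::conj_div_algebra ^ 'm) \<times> ('k ^ 'm)) set)"
proof (rule equivI)
  show "(line_rel :: (('k ^ 'm) \<times> ('k ^ 'm)) set) \<subseteq> (- {0}) \<times> (- {0})"
    by (auto simp: line_rel_def rscale_eq_0_iff)
  show "refl_on (- {0}) (line_rel :: (('k ^ 'm) \<times> ('k ^ 'm)) set)"
  proof (rule refl_onI)
    fix u :: "'k ^ 'm"
    assume "u \<in> - {0}"
    then show "(u, u) \<in> line_rel"
      by (simp add: line_rel_def) (rule exI[of _ 1], simp add: rscale_1)
  qed
  show "sym (line_rel :: (('k ^ 'm) \<times> ('k ^ 'm)) set)"
  proof (rule symI)
    fix u v :: "'k ^ 'm"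
    assume "(u, v) \<in> line_rel"
    then obtain c where c: "u \<noteq> 0" "c \<noteq> 0" "v = rscale u c"
      by (auto simp: line_rel_def)
    then have "u = rscale v (inverse c)" "v \<noteq> 0" "inverse c \<noteq> 0"
      by (simp_all add: rscale_rscale rscale_1 rscale_eq_0_iff)
    then show "(v, u) \<in> line_rel"
      unfolding line_rel_def by blast
  qed
  show "trans (line_rel :: (('k ^ 'm) \<times> ('k ^ 'm)) set)"
  proof (rule transI)
    fix u v w :: "'k ^ 'm"
    assume "(u, v) \<in> line_rel" "(v, w) \<in> line_rel"
    then obtain c d where c: "u \<noteq> 0" "c \<noteq> 0" "d \<noteq> 0" "v = rscale u c" "w = rscale v d"
      by (auto simp: line_rel_def)
    then have "w = rscale u (c * d)" "c * d \<noteq> 0"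
      by (simp_all add: rscale_rscale)
    with c(1) show "(u, w) \<in> line_rel"
      unfolding line_rel_def by blast
  qed
qed

text \<open>The space of lines through the origin in \<open>'k ^ 'm\<close>, of projective dimension
  \<open>CARD('m) - 1\<close>. A line is represented by the set of its nonzero vectors.\<close>

definition proj_space :: "('k::conj_div_algebra ^ 'm) set topology" where
  "proj_space = quotient_space (top_of_set (- {0})) line_rel"


section \<open>Stiefel manifold of 2-frames and the group P\<close>

definition hdot :: "'k::conj_div_algebra ^ 'm \<Rightarrow> 'k ^ 'm \<Rightarrow> 'k" where
  "hdot u v = (\<Sum>i\<in>UNIV. hconj (u $ i) * v $ i)"

text \<open>A frame \<open>(u v)\<close> is the matrix with columns \<open>u\<close> and \<open>v\<close>.\<close>

definition stiefel2 :: "('k::conj_div_algebra ^ 2 ^ 'm) set" where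
  "stiefel2 = {A. hdot (column 1 A) (column 1 A) = 1 \<and> hdot (column 2 A) (column 2 A) = 1
      \<and> hdot (column 1 A) (column 2 A) = 0}"

definition pdiag :: "'k::zero \<Rightarrow> 'k \<Rightarrow> 'k ^ 2 ^ 2" where
  "pdiag a b = vector [vector [a, 0], vector [0, b]]"

definition panti :: "'k::zero \<Rightarrow> 'k \<Rightarrow> 'k ^ 2 ^ 2" where
  "panti a b = vector [vector [0, a], vector [b, 0]]"

definition pgroup :: "('k::conj_div_algebra ^ 2 ^ 2) set" where
  "pgroup = {pdiag a b | a b. norm a = 1 \<and> norm b = 1}
          \<union> {panti a b | a b. norm a = 1 \<and> norm b = 1}"

definition ptau :: "'k::zero_neq_one ^ 2 ^ 2" where
  "ptau = panti 1 1"

text \<open>The left action of the group on the scalars, determined by the values on \<open>ptau\<close> and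
  on the matrices \<open>pdiag a b\<close> because \<open>panti a b = pdiag a b ** ptau\<close>.\<close>

definition paction :: "'k::conj_div_algebra ^ 2 ^ 2 \<Rightarrow> 'k \<Rightarrow> 'k" where
  "paction g k = (if g $ 1 $ 2 = 0 then g $ 1 $ 1 * k * hconj (g $ 2 $ 2)
                  else g $ 1 $ 2 * hconj k * hconj (g $ 2 $ 1))"

lemma pmat_nth [simp]:
  "pdiag a b $ 1 $ 1 = a" "pdiag a b $ 1 $ 2 = 0" "pdiag a b $ 2 $ 1 = 0" "pdiag a b $ 2 $ 2 = b"
  "panti a b $ 1 $ 1 = 0" "panti a b $ 1 $ 2 = a" "panti a b $ 2 $ 1 = b" "panti a b $ 2 $ 2 = 0"
  by (simp_all add: pdiag_def panti_def)

lemma pmat_mult: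
  fixes a b c d :: "'k::conj_div_algebra"
  shows "pdiag a b ** pdiag c d = pdiag (a * c) (b * d)"
    and "pdiag a b ** panti c d = panti (a * c) (b * d)"
    and "panti a b ** pdiag c d = panti (a * d) (b * c)"
    and "panti a b ** panti c d = pdiag (a * d) (b * c)"
  by (simp_all add: vec_eq_iff forall_2 matrix_matrix_mult_def sum_2)

lemma panti_eq_pdiag_ptau: "panti a b = pdiag a b ** (ptau :: 'k::conj_div_algebra ^ 2 ^ 2)"
  by (simp add: ptau_def pmat_mult)

lemma paction_ptau: "paction ptau k = hconj k"
  by (simp add: paction_def ptau_def)

lemma paction_pdiag: "paction (pdiag a b) k = a * k * hconj b"
  by (simp add: paction_def)

lemma paction_panti: "norm a = 1 \<Longrightarrow> paction (panti a b) k = a * hconj k * hconj b"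
  by (auto simp: paction_def)

lemma pgroupE:
  assumes "g \<in> pgroup"
  obtains a b where "norm a = 1" "norm b = 1" "g = pdiag a b"
    | a b where "norm a = 1" "norm b = 1" "g = panti a b"
  using assms unfolding pgroup_def by blast

lemma pdiag_pgroup: "norm a = 1 \<Longrightarrow> norm b = 1 \<Longrightarrow> pdiag a b \<in> pgroup"
  by (auto simp: pgroup_def)

lemma panti_pgroup: "norm a = 1 \<Longrightarrow> norm b = 1 \<Longrightarrow> panti a b \<in> pgroup"
  by (auto simp: pgroup_def)

lemma mat_1_eq_pdiag: "mat 1 = pdiag 1 (1 :: 'k::conj_div_algebra)"
  by (simp add: vec_eq_iff forall_2 mat_def)

lemma pgroup_one: "mat 1 \<in> pgroup"
  by (simp add: mat_1_eq_pdiag pdiag_pgroup)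

lemma pgroup_mult: "g \<in> pgroup \<Longrightarrow> h \<in> pgroup \<Longrightarrow> g ** h \<in> pgroup"
  by (elim pgroupE) (auto simp: pmat_mult norm_mult intro!: pdiag_pgroup panti_pgroup)

lemma pgroup_inverse:
  assumes "g \<in> pgroup"
  obtains h where "h \<in> pgroup" "g ** h = mat 1" "h ** g = mat 1"
  using assms
proof (cases rule: pgroupE)
  case (1 a b)
  then show ?thesis
    by (intro that[of "pdiag (hconj a) (hconj b)"])
      (simp_all add: pdiag_pgroup pmat_mult hconj_mult_unit mat_1_eq_pdiag)
next
  case (2 a b)
  then show ?thesis
    by (intro that[of "panti (hconj b) (hconj a)"])
      (simp_all add: panti_pgroup pmat_mult hconj_mult_unit mat_1_eq_pdiag)
qed

lemma paction_one: "paction (mat 1) k = k"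
  by (simp add: mat_1_eq_pdiag paction_pdiag)

lemma paction_mult:
  "g \<in> pgroup \<Longrightarrow> h \<in> pgroup \<Longrightarrow> paction (g ** h) k = paction g (paction h k)"
  by (elim pgroupE)
    (simp_all add: pmat_mult paction_pdiag paction_panti norm_mult hconj_mult mult.assoc)

lemma norm_paction: "g \<in> pgroup \<Longrightarrow> norm (paction g k) = norm k"
  by (elim pgroupE) (simp_all add: paction_pdiag paction_panti norm_mult)

lemma stiefel2_mult:
  fixes A :: "'k::conj_div_algebra ^ 2 ^ 'm"
  assumes A: "A \<in> stiefel2" and g: "g \<in> pgroup"
  shows "A ** g \<in> stiefel2"
proof -
  have hconj_sum: "hconj (sum f S) = (\<Sum>i\<in>S. hconj (f i))" for f :: "'m \<Rightarrow> 'k" and S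
    by (induction S rule: infinite_finite_induct) (simp_all add: hconj_add)
  have sc: "hdot (rscale u c) (rscale v d) = hconj c * hdot u v * d" for u v :: "'k ^ 'm" and c d
    by (simp add: hdot_def rscale_def hconj_mult sum_distrib_left sum_distrib_right mult.assoc)
  have sym: "hdot u v = hconj (hdot v u)" for u v :: "'k ^ 'm"
    by (simp add: hdot_def hconj_sum hconj_mult)
  have cols:
    "column 1 (A ** pdiag a b) = rscale (column 1 A) a"
    "column 2 (A ** pdiag a b) = rscale (column 2 A) b"
    "column 1 (A ** panti a b) = rscale (column 2 A) b"
    "column 2 (A ** panti a b) = rscale (column 1 A) a" for a b
    by (simp_all add: vec_eq_iff column_def rscale_def matrix_matrix_mult_def sum_2)
  have "hdot (column 2 A) (column 1 A) = 0"
    using A sym[of "column 2 A" "column 1 A"] by (simp add: stiefel2_def)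
  with A g show ?thesis
    by (elim pgroupE) (simp_all add: stiefel2_def cols sc hconj_mult_unit)
qed


section \<open>The orbit space and the associated bundle\<close>

definition frame_rel :: "(('k::conj_div_algebra ^ 2 ^ 'm) \<times> ('k ^ 2 ^ 'm)) set" where
  "frame_rel = {(A, B). A \<in> stiefel2 \<and> (\<exists>g\<in>pgroup. B = A ** g)}"

definition Gamma_space :: "('k::conj_div_algebra ^ 2 ^ 'm) set topology" where
  "Gamma_space = quotient_space (top_of_set stiefel2) frame_rel"

text \<open>The balanced product of \<open>stiefel2\<close> with an invariant set \<open>F\<close> of scalars:
  \<open>(A ** g, k)\<close> is identified with \<open>(A, paction g k)\<close>.\<close>

definition bundle_rel ::
    "'k set \<Rightarrow> ((('k::conj_div_algebra ^ 2 ^ 'm) \<times> 'k) \<times> (('k ^ 2 ^ 'm) \<times> 'k)) set" where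
  "bundle_rel F = {((A ** g, k), (A, paction g k)) | A g k. A \<in> stiefel2 \<and> g \<in> pgroup \<and> k \<in> F}"

definition assoc_bundle :: "'k set \<Rightarrow> (('k::conj_div_algebra ^ 2 ^ 'm) \<times> 'k) set topology" where
  "assoc_bundle F =
     quotient_space (prod_topology (top_of_set stiefel2) (top_of_set F)) (bundle_rel F)"

text \<open>The total space of the bundle \<open>\<theta>\<close> is \<open>assoc_bundle UNIV\<close>; the following is the total
  space of its open unit disc bundle.\<close>

definition open_disc_bundle :: "(('k::conj_div_algebra ^ 2 ^ 'm) \<times> 'k) set topology" where
  "open_disc_bundle = assoc_bundle {k. norm k < 1}"

lemma equiv_frame_rel:
  "equiv stiefel2 (frame_rel :: (('k::conj_div_algebra ^ 2 ^ 'm) \<times> ('k ^ 2 ^ 'm)) set)"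
proof (rule equivI)
  show "(frame_rel :: (('k ^ 2 ^ 'm) \<times> ('k ^ 2 ^ 'm)) set) \<subseteq> stiefel2 \<times> stiefel2"
    by (auto simp: frame_rel_def stiefel2_mult)
  show "refl_on stiefel2 (frame_rel :: (('k ^ 2 ^ 'm) \<times> ('k ^ 2 ^ 'm)) set)"
    by (rule refl_onI) (auto simp: frame_rel_def intro!: bexI[OF _ pgroup_one])
  show "sym (frame_rel :: (('k ^ 2 ^ 'm) \<times> ('k ^ 2 ^ 'm)) set)"
  proof (rule symI)
    fix A B :: "'k ^ 2 ^ 'm"
    assume "(A, B) \<in> frame_rel"
    then obtain g where A: "A \<in> stiefel2" and g: "g \<in> pgroup" "B = A ** g"
      by (auto simp: frame_rel_def)
    obtain h where h: "h \<in> pgroup" "g ** h = mat 1"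
      using pgroup_inverse[OF g(1)] by metis
    then have "A = B ** h"
      using g by (simp flip: matrix_mul_assoc)
    then show "(B, A) \<in> frame_rel"
      using A g h by (auto simp: frame_rel_def stiefel2_mult)
  qed
  show "trans (frame_rel :: (('k ^ 2 ^ 'm) \<times> ('k ^ 2 ^ 'm)) set)"
    by (rule transI) (auto simp: frame_rel_def pgroup_mult simp flip: matrix_mul_assoc
        intro!: bexI[OF _ pgroup_mult])
qed

lemma equiv_bundle_rel:
  fixes F :: "'k::conj_div_algebra set"
  assumes F: "\<And>g k. g \<in> pgroup \<Longrightarrow> k \<in> F \<Longrightarrow> paction g k \<in> F"
  shows "equiv (stiefel2 \<times> F)
    (bundle_rel F :: ((('k ^ 2 ^ 'm) \<times> 'k) \<times> (('k ^ 2 ^ 'm) \<times> 'k)) set)"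
    (is "equiv _ ?r")
proof (rule equivI)
  have I: "((B, k), (A, l)) \<in> ?r"
    if "A \<in> stiefel2" "g \<in> pgroup" "k \<in> F" "B = A ** g" "l = paction g k" for A B k l g
    using that unfolding bundle_rel_def by blast
  show "?r \<subseteq> (stiefel2 \<times> F) \<times> (stiefel2 \<times> F)"
    by (auto simp: bundle_rel_def stiefel2_mult F)
  show "refl_on (stiefel2 \<times> F) ?r"
    by (rule refl_onI) (auto intro!: I[OF _ pgroup_one] simp: paction_one)
  show "sym ?r"
  proof (rule symI)
    fix p q
    assume "(p, q) \<in> ?r"
    then obtain A g k where pq: "p = (A ** g, k)" "q = (A, paction g k)"
      and *: "A \<in> stiefel2" "g \<in> pgroup" "k \<in> F"
      by (auto simp: bundle_rel_def)
    obtain h where h: "h \<in> pgroup" "g ** h = mat 1" "h ** g = mat 1"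
      using pgroup_inverse[OF *(2)] by metis
    show "(q, p) \<in> ?r"
      unfolding pq
    proof (rule I)
      show "A = (A ** g) ** h"
        using h by (simp flip: matrix_mul_assoc)
      show "k = paction h (paction g k)"
        using h * by (simp flip: paction_mult add: paction_one)
    qed (use h * in \<open>simp_all add: stiefel2_mult F\<close>)
  qed
  show "trans ?r"
  proof (rule transI)
    fix p q s
    assume "(p, q) \<in> ?r" "(q, s) \<in> ?r"
    then obtain A g k B h l where 1: "p = (A ** g, k)" "q = (A, paction g k)"
        "g \<in> pgroup" "k \<in> F"
      and 2: "q = (B ** h, l)" "s = (B, paction h l)" "B \<in> stiefel2" "h \<in> pgroup"
      unfolding bundle_rel_def by blast
    have "p = (B ** (h ** g), k)" "s = (B, paction (h ** g) k)"
      using 1 2 by (simp_all add: matrix_mul_assoc paction_mult)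
    then show "(p, s) \<in> ?r"
      using I[OF 2(3) pgroup_mult[OF 2(4) 1(3)] 1(4)] by simp
  qed
qed

end

theory Submission
  imports Defs
begin

text \<open>
  The argument is uniform in the scalars: it uses only a normed division algebra with
  conjugation, so the complex and the quaternionic statements are instances of the same two
  theorems.

  Two distinct lines span a plane, and in that plane there is a canonical pair of orthogonal
  lines from which they arise by leaning the two members of an orthogonal pair towards each
  other by equal amounts. In formulas, an orthonormal frame \<open>(u v)\<close> and a scalar \<open>k\<close> with
  \<open>\<bar>k\<bar> < 1\<close> give the vectors \<open>x = u + v k\<^sup>*\<close> and \<open>y = u k + v\<close>, where \<open>k\<^sup>*\<close> is the conjugate; that is,
  the frame is multiplied by the Hermitian matrix with rows \<open>(1 k)\<close> and \<open>(k\<^sup>* 1)\<close>. Both vectors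
  have squared norm \<open>1 + \<bar>k\<bar>\<^sup>2\<close> and their inner product is \<open>2 k\<close>, so the lines are distinct as
  long as \<open>\<bar>k\<bar> < 1\<close>. Replacing the frame by \<open>(u v) g\<close> with \<open>g\<close> in the group changes \<open>k\<close> as in the
  disc bundle and changes \<open>x\<close> and \<open>y\<close> only by unit scalars and by their order
  (\<open>skew_pdiag\<close>, \<open>skew_panti\<close>), hence does not change the unordered pair of lines. Conversely,
  the pair of lines determines the frame and the scalar up to the group
  (\<open>line_pair_skew_eq_iff\<close>).

  The inverse is a polar decomposition. For unit vectors \<open>x\<close>, \<open>y\<close> with inner product \<open>c\<close>, the scalar
  is the solution \<open>k\<close> of \<open>(1 + \<bar>k\<bar>\<^sup>2) c = 2 k\<close> in the open unit disc, and \<open>u\<close>, \<open>v\<close> are real multiples of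
  \<open>x - y k\<^sup>*\<close> and \<open>y - x k\<close>. Both depend continuously on \<open>x\<close> and \<open>y\<close>
  (\<open>straighten\<close>, \<open>continuous_on_straighten\<close>).

  The topological part compares two quotient maps that are both defined on the pairs
  \<open>(A, k)\<close> of a frame and a disc scalar. One is the projection to the disc bundle. The other
  sends \<open>(A, k)\<close> to the pair of lines; it is a quotient map because precomposing it with the
  continuous map \<open>straighten\<close> gives the map from noncollinear pairs of vectors to the
  configuration space (\<open>quotient_map_line_pair_skew\<close>), and the latter is a quotient map
  since it is a restriction of an open one (\<open>quotient_map_line_pair\<close>). As the two quotient maps have the
  same fibres, their targets are homeomorphic.

  Finally, shrinking the discs by \<open>k \<mapsto> t k\<close> is compatible with the group action and retracts
  the disc bundle onto its zero section, which gives the homotopy equivalence with the base.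
\<close>

section \<open>Open quotient maps\<close>

text \<open>The saturation of an open set \<open>U\<close> is the union of the preimages of \<open>U\<close> under the maps
  \<open>\<phi> g\<close>, hence open.\<close>

lemma open_map_orbit_quotient:
  assumes r: "equiv (topspace X) r"
    and orbits: "r = {(x, \<phi> g x) | x g. x \<in> topspace X \<and> g \<in> G}"
    and cont: "\<And>g. g \<in> G \<Longrightarrow> continuous_map X X (\<phi> g)"
  shows "open_map X (quotient_space X r) (\<lambda>x. r `` {x})"
  unfolding open_map_def openin_quotient_space
proof (intro allI impI conjI)
  fix U assume U: "openin X U"
  then have UX: "U \<subseteq> topspace X" by (rule openin_subset)
  then show "(\<lambda>x. r `` {x}) ` U \<subseteq> topspace X // r"
    by (auto simp: quotient_def)
  have "{x \<in> topspace X. r `` {x} \<in> (\<lambda>x. r `` {x}) ` U} = {x \<in> topspace X. \<exists>u\<in>U. (x, u) \<in> r}"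
    using eq_equiv_class_iff[OF r] UX by blast
  also have "\<dots> = (\<Union>g\<in>G. {x \<in> topspace X. \<phi> g x \<in> U})"
    unfolding orbits by auto
  also have "openin X \<dots>"
    using openin_continuous_map_preimage[OF cont U] by blast
  finally show "openin X {x \<in> topspace X. r `` {x} \<in> (\<lambda>x. r `` {x}) ` U}" .
qed

lemma open_map_prod_map:
  assumes f: "open_map X X' f" and g: "open_map Y Y' g"
  shows "open_map (prod_topology X Y) (prod_topology X' Y') (map_prod f g)"
  unfolding open_map_def
proof (intro allI impI)
  fix W assume W: "openin (prod_topology X Y) W"
  show "openin (prod_topology X' Y') (map_prod f g ` W)"
    unfolding openin_prod_topology_alt
  proof (intro allI impI)
    fix a b assume "(a, b) \<in> map_prod f g ` W"
    then obtain x y where xy: "(x, y) \<in> W" "a = f x" "b = g y" by auto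
    then obtain U V where UV: "openin X U" "openin Y V" "x \<in> U" "y \<in> V" "U \<times> V \<subseteq> W"
      using W[unfolded openin_prod_topology_alt, rule_format, OF xy(1)] by blast
    have "f ` U \<times> g ` V \<subseteq> map_prod f g ` W"
    proof clarify
      fix u v assume "u \<in> U" "v \<in> V"
      with UV(5) show "(f u, g v) \<in> map_prod f g ` W"
        by (intro image_eqI[of _ _ "(u, v)"]) auto
    qed
    then show "\<exists>U V. openin X' U \<and> openin Y' V \<and> a \<in> U \<and> b \<in> V \<and> U \<times> V \<subseteq> map_prod f g ` W"
      using UV xy f[unfolded open_map_def, rule_format, OF UV(1)]
        g[unfolded open_map_def, rule_format, OF UV(2)]
      by (intro exI[of _ "f ` U"] exI[of _ "g ` V"]) auto
  qed
qed

text \<open>A quotient map need not restrict to a quotient map on an arbitrary saturated subset, but an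
  open map restricts to an open one. This is why openness is proved for the maps below.\<close>

lemma open_quotient_map_restriction:
  assumes f: "quotient_map X Y f" "open_map X Y f" and V: "V \<subseteq> topspace Y"
  shows "quotient_map (subtopology X {x \<in> topspace X. f x \<in> V}) (subtopology Y V) f"
proof (rule continuous_open_imp_quotient_map)
  show "continuous_map (subtopology X {x \<in> topspace X. f x \<in> V}) (subtopology Y V) f"
    using quotient_imp_continuous_map[OF f(1)]
    by (auto simp: continuous_map_in_subtopology continuous_map_from_subtopology)
  show "open_map (subtopology X {x \<in> topspace X. f x \<in> V}) (subtopology Y V) f"
    by (rule open_map_restriction[OF f(2) refl])
  show "f ` topspace (subtopology X {x \<in> topspace X. f x \<in> V}) = topspace (subtopology Y V)"
    using V quotient_imp_surjective_map[OF f(1)] by auto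
qed

text \<open>Each of the two maps factors through the other, and the factors are mutually inverse.\<close>

lemma homeomorphic_space_of_quotient_maps:
  assumes f: "quotient_map X Y f" and g: "quotient_map X Z g"
    and fibres: "\<And>x y. x \<in> topspace X \<Longrightarrow> y \<in> topspace X \<Longrightarrow> f x = f y \<longleftrightarrow> g x = g y"
  shows "Y homeomorphic_space Z"
proof -
  obtain h where h: "continuous_map Y Z h" "\<And>x. x \<in> topspace X \<Longrightarrow> h (f x) = g x"
    using quotient_map_lift_exists[OF f quotient_imp_continuous_map[OF g]] fibres by metis
  obtain h' where h': "continuous_map Z Y h'" "\<And>x. x \<in> topspace X \<Longrightarrow> h' (g x) = f x"
    using quotient_map_lift_exists[OF g quotient_imp_continuous_map[OF f]] fibres by metis
  have "homeomorphic_maps Y Z h h'"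
    unfolding homeomorphic_maps_def
    using h h' quotient_imp_surjective_map[OF f] quotient_imp_surjective_map[OF g] by force
  then show ?thesis
    unfolding homeomorphic_space_def by blast
qed

section \<open>Configuration spaces of quotient spaces\<close>

lemma swap_class_eq_iff:
  assumes "a \<in> S" "b \<in> S" "c \<in> S" "d \<in> S"
  shows "swap_rel S `` {(a, b)} = swap_rel S `` {(c, d)} \<longleftrightarrow> a = c \<and> b = d \<or> a = d \<and> b = c"
proof -
  have "swap_rel S `` {(a, b)} = swap_rel S `` {(c, d)} \<longleftrightarrow> ((a, b), (c, d)) \<in> swap_rel S"
    using assms eq_equiv_class_iff[OF equiv_swap_rel[of S]] by simp
  also have "\<dots> \<longleftrightarrow> a = c \<and> b = d \<or> a = d \<and> b = c"
    using assms by (auto simp: swap_rel_def)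
  finally show ?thesis .
qed

text \<open>The classes are the orbits of the identity and the swap, both continuous.\<close>

lemma open_map_SP2:
  "open_map (prod_topology X X) (SP2 X) (\<lambda>p. swap_rel (topspace X) `` {p})"
  unfolding SP2_def
proof (rule open_map_orbit_quotient[where \<phi> = "\<lambda>g. g" and G = "{\<lambda>p. p, prod.swap}"])
  show "continuous_map (prod_topology X X) (prod_topology X X) g" if "g \<in> {\<lambda>p. p, prod.swap}" for g
    using that by (auto simp: continuous_map_pairwise o_def continuous_map_fst continuous_map_snd)
  show "equiv (topspace (prod_topology X X)) (swap_rel (topspace X))"
    by (simp add: equiv_swap_rel)
qed (auto simp: swap_rel_def)

lemma quotient_map_SP2:
  "quotient_map (prod_topology X X) (SP2 X) (\<lambda>p. swap_rel (topspace X) `` {p})"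
  unfolding SP2_def by (rule quotient_map_quotient_space)

lemma swap_class_in_diagonal_iff:
  assumes "a \<in> topspace X" "b \<in> topspace X"
  shows "swap_rel (topspace X) `` {(a, b)} \<in> SP2_diagonal X \<longleftrightarrow> a = b"
  using assms swap_class_eq_iff[of a "topspace X" b] by (auto simp: SP2_diagonal_def)

text \<open>Taking the product with itself destroys quotient maps in general, and so does the
  restriction to the complement of the diagonal; both steps are harmless when \<open>f\<close> is open.\<close>

lemma quotient_map_conf2:
  assumes f: "quotient_map X Y f" "open_map X Y f"
  shows "quotient_map
           (subtopology (prod_topology X X) {(x, y). x \<in> topspace X \<and> y \<in> topspace X \<and> f x \<noteq> f y})
           (conf2 Y) (\<lambda>(x, y). swap_rel (topspace Y) `` {(f x, f y)})"
proof -
  let ?q = "\<lambda>p. swap_rel (topspace Y) `` {p}"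
  have fX: "f x \<in> topspace Y" if "x \<in> topspace X" for x
    using that quotient_imp_surjective_map[OF f(1)] by blast
  have eq: "(\<lambda>(x, y). swap_rel (topspace Y) `` {(f x, f y)}) = ?q \<circ> map_prod f f"
    by auto
  have op: "open_map (prod_topology X X) (SP2 Y) (?q \<circ> map_prod f f)"
    by (intro open_map_compose[OF open_map_prod_map open_map_SP2] f)
  have "quotient_map (prod_topology X X) (prod_topology Y Y) (map_prod f f)"
  proof (rule continuous_open_imp_quotient_map)
    show "continuous_map (prod_topology X X) (prod_topology Y Y) (map_prod f f)"
      using quotient_imp_continuous_map[OF f(1)]
      by (simp add: map_prod_def continuous_map_prod_top)
    show "map_prod f f ` topspace (prod_topology X X) = topspace (prod_topology Y Y)"
      using quotient_imp_surjective_map[OF f(1)] by (simp add: map_prod_surj_on)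
  qed (intro open_map_prod_map f)
  then have "quotient_map (prod_topology X X) (SP2 Y) (?q \<circ> map_prod f f)"
    by (rule quotient_map_compose[OF _ quotient_map_SP2])
  from open_quotient_map_restriction[OF this op, of "topspace (SP2 Y) - SP2_diagonal Y"]
  have "quotient_map (subtopology (prod_topology X X) {x \<in> topspace (prod_topology X X).
      (?q \<circ> map_prod f f) x \<in> topspace (SP2 Y) - SP2_diagonal Y}) (conf2 Y) (?q \<circ> map_prod f f)"
    by (simp add: conf2_def)
  moreover have "{x \<in> topspace (prod_topology X X).
      (?q \<circ> map_prod f f) x \<in> topspace (SP2 Y) - SP2_diagonal Y} =
      {(x, y). x \<in> topspace X \<and> y \<in> topspace X \<and> f x \<noteq> f y}"
  proof -
    have "?q (f x, f y) \<in> topspace (SP2 Y)" if "x \<in> topspace X" "y \<in> topspace X" for x y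
      using that fX quotient_imp_surjective_map[OF quotient_map_SP2[of Y]] by force
    then show ?thesis
      using fX by (auto simp: swap_class_in_diagonal_iff)
  qed
  ultimately show ?thesis
    unfolding eq by simp
qed

section \<open>Hermitian algebra\<close>

text \<open>Conjugation is an isometry, which makes every formula below continuous in its arguments.\<close>

lemma bounded_linear_hconj: "bounded_linear (hconj :: 'k::conj_div_algebra \<Rightarrow> 'k)"
  by (rule bounded_linear_intro[where K = 1]) (simp_all add: hconj_add hconj_scaleR)

lemma hconj_minus: "hconj (- x) = - hconj (x :: 'k::conj_div_algebra)"
  using hconj_scaleR[of "-1" x] by simp

lemma hconj_diff: "hconj (x - y) = hconj x - hconj (y :: 'k::conj_div_algebra)"
  using hconj_add[of x "- y"] by (simp add: hconj_minus)

lemma hconj_sum: "hconj (sum f S) = (\<Sum>i\<in>S. hconj (f i :: 'k::conj_div_algebra))"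
  by (induction S rule: infinite_finite_induct) (simp_all add: hconj_add)

lemma hconj_mult_self': "x * hconj x = (norm x)\<^sup>2 *\<^sub>R (1 :: 'k::conj_div_algebra)"
  using hconj_mult_self[of "hconj x"] by simp

lemma hdot_add_left: "hdot (u + v) w = hdot u w + hdot v w"
  by (simp add: hdot_def hconj_add distrib_right sum.distrib)

lemma hdot_add_right: "hdot u (v + w) = hdot u v + hdot u w"
  by (simp add: hdot_def distrib_left sum.distrib)

lemma hdot_diff_left: "hdot (u - v) w = hdot u w - hdot v w"
  by (simp add: hdot_def hconj_diff left_diff_distrib sum_subtractf)

lemma hdot_diff_right: "hdot u (v - w) = hdot u v - hdot u w"
  by (simp add: hdot_def right_diff_distrib sum_subtractf)

lemma hdot_rscale_left: "hdot (rscale u c) v = hconj c * hdot u v"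
  by (simp add: hdot_def rscale_def hconj_mult sum_distrib_left mult.assoc)

lemma hdot_rscale_right: "hdot u (rscale v c) = hdot u v * c"
  by (simp add: hdot_def rscale_def sum_distrib_right mult.assoc)

lemma hdot_scaleR_left: "hdot (r *\<^sub>R u) v = r *\<^sub>R hdot u v"
  by (simp add: hdot_def hconj_scaleR scaleR_sum_right)

lemma hdot_scaleR_right: "hdot u (r *\<^sub>R v) = r *\<^sub>R hdot u v"
  by (simp add: hdot_def scaleR_sum_right)

lemma hdot_commute: "hdot v u = hconj (hdot u v)"
  by (simp add: hdot_def hconj_sum hconj_mult)

lemma hdot_self: "hdot u u = (norm u)\<^sup>2 *\<^sub>R (1 :: 'k::conj_div_algebra)"
  by (simp add: hdot_def hconj_mult_self norm_vec_def L2_set_def sum_nonneg flip: scaleR_left.sum)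

lemmas hdot_simps = hdot_add_left hdot_add_right hdot_diff_left hdot_diff_right
  hdot_rscale_left hdot_rscale_right hdot_scaleR_left hdot_scaleR_right

lemma rscale_add_left: "rscale (u + v) c = rscale u c + rscale v (c :: 'k::conj_div_algebra)"
  by (simp add: rscale_def vec_eq_iff distrib_right)

lemma rscale_diff_left: "rscale (u - v) c = rscale u c - rscale v (c :: 'k::conj_div_algebra)"
  by (simp add: rscale_def vec_eq_iff left_diff_distrib)

lemma rscale_scaleR_left: "rscale (r *\<^sub>R u) c = r *\<^sub>R rscale u (c :: 'k::conj_div_algebra)"
  by (simp add: rscale_def vec_eq_iff)

lemma rscale_scaleR_right: "rscale u (r *\<^sub>R c) = r *\<^sub>R rscale u (c :: 'k::conj_div_algebra)"
  by (simp add: rscale_def vec_eq_iff)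

lemma continuous_on_hconj [continuous_intros]:
  "continuous_on S f \<Longrightarrow> continuous_on S (\<lambda>x. hconj (f x :: 'k::conj_div_algebra))"
  using bounded_linear.continuous_on[OF bounded_linear_hconj] .

lemma continuous_on_rscale [continuous_intros]:
  fixes f :: "'a::topological_space \<Rightarrow> 'k::conj_div_algebra ^ 'm"
  shows "continuous_on S f \<Longrightarrow> continuous_on S g \<Longrightarrow> continuous_on S (\<lambda>x. rscale (f x) (g x))"
  unfolding rscale_def by (intro continuous_intros)

lemma continuous_on_hdot [continuous_intros]:
  fixes f :: "'a::topological_space \<Rightarrow> 'k::conj_div_algebra ^ 'm"
  shows "continuous_on S f \<Longrightarrow> continuous_on S g \<Longrightarrow> continuous_on S (\<lambda>x. hdot (f x) (g x))"
  unfolding hdot_def by (intro continuous_intros)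

lemma continuous_on_column [continuous_intros]:
  fixes f :: "'a::topological_space \<Rightarrow> 'k::topological_space ^ 'n ^ 'm"
  shows "continuous_on S f \<Longrightarrow> continuous_on S (\<lambda>x. column j (f x))"
  unfolding column_def by (intro continuous_intros)

definition frame :: "'k ^ 'm \<Rightarrow> 'k ^ 'm \<Rightarrow> 'k ^ 2 ^ 'm" where
  "frame u v = (\<chi> i j. if j = 1 then u $ i else v $ i)"

lemma column_frame [simp]: "column 1 (frame u v) = u" "column 2 (frame u v) = v"
  by (simp_all add: frame_def column_def vec_eq_iff)

lemma frame_eq_iff: "A = B \<longleftrightarrow> column 1 A = column 1 B \<and> column 2 A = column 2 B"
  for A :: "'k ^ 2 ^ 'm"
  by (auto simp: column_def vec_eq_iff forall_2)

lemma frame_mult_pgroup: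
  fixes A :: "'k::conj_div_algebra ^ 2 ^ 'm"
  shows "column 1 (A ** pdiag a b) = rscale (column 1 A) a"
    and "column 2 (A ** pdiag a b) = rscale (column 2 A) b"
    and "column 1 (A ** panti a b) = rscale (column 2 A) b"
    and "column 2 (A ** panti a b) = rscale (column 1 A) a"
  by (simp_all add: vec_eq_iff column_def rscale_def matrix_matrix_mult_def sum_2)

lemma continuous_on_frame [continuous_intros]:
  fixes f :: "'a::topological_space \<Rightarrow> 'k::topological_space ^ 'm"
  assumes "continuous_on S f" "continuous_on S g"
  shows "continuous_on S (\<lambda>x. frame (f x) (g x))"
proof -
  have "continuous_on S (\<lambda>x. if j = (1::2) then f x $ i else g x $ i)" for i j
    using assms by (cases "j = 1") (auto intro!: continuous_intros)
  then show ?thesis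
    unfolding frame_def by (intro continuous_on_vec_lambda)
qed

section \<open>Pairs of lines as classes of noncollinear vectors\<close>

lemma line_eq_iff:
  fixes x y :: "'k::conj_div_algebra ^ 'm"
  assumes "x \<noteq> 0" "y \<noteq> 0"
  shows "line_rel `` {x} = line_rel `` {y} \<longleftrightarrow> (\<exists>c. c \<noteq> 0 \<and> y = rscale x c)"
  using eq_equiv_class_iff[OF equiv_line_rel, of x y] assms by (auto simp: line_rel_def)

lemma line_rscale:
  fixes x :: "'k::conj_div_algebra ^ 'm"
  assumes "x \<noteq> 0" "c \<noteq> 0"
  shows "line_rel `` {rscale x c} = line_rel `` {x}"
  using assms line_eq_iff[of x "rscale x c"] by (auto simp: rscale_eq_0_iff)

lemma line_scaleR:
  fixes x :: "'k::conj_div_algebra ^ 'm"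
  assumes "x \<noteq> 0" "r \<noteq> 0"
  shows "line_rel `` {r *\<^sub>R x} = line_rel `` {x}"
  using line_rscale[of x "r *\<^sub>R 1"] assms by (simp add: rscale_scaleR_right rscale_1)

lemma quotient_map_line:
  "quotient_map (top_of_set (- {0})) proj_space (\<lambda>x :: 'k::conj_div_algebra ^ 'm. line_rel `` {x})"
  unfolding proj_space_def by (rule quotient_map_quotient_space)

text \<open>Lines are the orbits of the nonzero scalars acting by multiplication.\<close>

lemma open_map_line:
  "open_map (top_of_set (- {0})) proj_space (\<lambda>x :: 'k::conj_div_algebra ^ 'm. line_rel `` {x})"
  unfolding proj_space_def
proof (rule open_map_orbit_quotient[where \<phi> = "\<lambda>c x. rscale x c" and G = "- {0}"])
  show "equiv (topspace (top_of_set (- {0}))) (line_rel :: (('k ^ 'm) \<times> ('k ^ 'm)) set)"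
    by (simp add: equiv_line_rel)
  show "continuous_map (top_of_set (- {0})) (top_of_set (- {0})) (\<lambda>x :: 'k ^ 'm. rscale x c)"
    if "c \<in> - {0}" for c
    using that
    by (auto simp: continuous_map_in_subtopology rscale_eq_0_iff intro!: continuous_intros)
qed (auto simp: line_rel_def)

definition noncollinear :: "(('k::conj_div_algebra ^ 'm) \<times> ('k ^ 'm)) set" where
  "noncollinear = {(x, y). x \<noteq> 0 \<and> y \<noteq> 0 \<and> line_rel `` {x} \<noteq> line_rel `` {y}}"

definition line_pair :: "('k::conj_div_algebra ^ 'm) \<times> ('k ^ 'm) \<Rightarrow> (('k ^ 'm) set \<times> ('k ^ 'm) set) set" where
  "line_pair = (\<lambda>(x, y). swap_rel (topspace proj_space) `` {(line_rel `` {x}, line_rel `` {y})})"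

lemma quotient_map_line_pair:
  "quotient_map (top_of_set (noncollinear :: (('k::conj_div_algebra ^ 'm) \<times> ('k ^ 'm)) set))
     (conf2 proj_space) line_pair"
proof -
  have eq: "subtopology (prod_topology (top_of_set (- {0})) (top_of_set (- {0})))
      {(x, y). x \<in> topspace (top_of_set (- {0})) \<and> y \<in> topspace (top_of_set (- {0})) \<and>
        line_rel `` {x} \<noteq> line_rel `` {y}} =
      top_of_set (noncollinear :: (('k ^ 'm) \<times> ('k ^ 'm)) set)"
  proof -
    have "(- {0}) \<times> (- {0}) \<inter> {(x, y). x \<in> - {0} \<and> y \<in> - {0} \<and>
        line_rel `` {x} \<noteq> line_rel `` {y}} = (noncollinear :: (('k ^ 'm) \<times> ('k ^ 'm)) set)"
      unfolding noncollinear_def by blast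
    then show ?thesis
      by (simp add: subtopology_subtopology)
  qed
  show ?thesis
    unfolding eq[symmetric] line_pair_def
    by (rule quotient_map_conf2[OF quotient_map_line open_map_line])
qed

lemma line_pair_eq_iff:
  fixes x y x' y' :: "'k::conj_div_algebra ^ 'm"
  assumes "x \<noteq> 0" "y \<noteq> 0" "x' \<noteq> 0" "y' \<noteq> 0"
  shows "line_pair (x, y) = line_pair (x', y') \<longleftrightarrow>
    line_rel `` {x} = line_rel `` {x'} \<and> line_rel `` {y} = line_rel `` {y'} \<or>
    line_rel `` {x} = line_rel `` {y'} \<and> line_rel `` {y} = line_rel `` {x'}"
proof -
  have "line_rel `` {z} \<in> topspace proj_space" if "z \<noteq> 0" for z :: "'k ^ 'm"
    using that by (auto simp: proj_space_def topspace_quotient_space intro: quotientI)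
  then show ?thesis
    unfolding line_pair_def using assms by (simp add: swap_class_eq_iff)
qed

section \<open>Skewing an orthonormal frame\<close>

text \<open>The vectors \<open>skew1 A k\<close> and \<open>skew2 A k\<close> are the columns of the frame \<open>A\<close> multiplied by the
  Hermitian matrix with rows \<open>(1 k)\<close> and \<open>(hconj k 1)\<close>.\<close>

definition skew1 :: "'k::conj_div_algebra ^ 2 ^ 'm \<Rightarrow> 'k \<Rightarrow> 'k ^ 'm" where
  "skew1 A k = column 1 A + rscale (column 2 A) (hconj k)"

definition skew2 :: "'k::conj_div_algebra ^ 2 ^ 'm \<Rightarrow> 'k \<Rightarrow> 'k ^ 'm" where
  "skew2 A k = rscale (column 1 A) k + column 2 A"

text \<open>Moving a group element past the Hermitian matrix turns \<open>k\<close> into \<open>paction g k\<close>: this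
  identity is what makes the pair of lines depend only on the class in the disc bundle.\<close>

lemma skew_pdiag:
  fixes A :: "'k::conj_div_algebra ^ 2 ^ 'm"
  assumes "norm a = 1" "norm b = 1"
  shows "skew1 (A ** pdiag a b) k = rscale (skew1 A (paction (pdiag a b) k)) a"
    and "skew2 (A ** pdiag a b) k = rscale (skew2 A (paction (pdiag a b) k)) b"
  using assms by (simp_all add: skew1_def skew2_def frame_mult_pgroup paction_pdiag hconj_mult
      rscale_add_left rscale_rscale mult.assoc hconj_mult_unit)

lemma skew_panti:
  fixes A :: "'k::conj_div_algebra ^ 2 ^ 'm"
  assumes "norm a = 1" "norm b = 1"
  shows "skew1 (A ** panti a b) k = rscale (skew2 A (paction (panti a b) k)) b"
    and "skew2 (A ** panti a b) k = rscale (skew1 A (paction (panti a b) k)) a"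
  using assms by (simp_all add: skew1_def skew2_def frame_mult_pgroup paction_panti hconj_mult
      rscale_add_left rscale_rscale mult.assoc hconj_mult_unit add.commute)

lemma stiefel2D:
  assumes "A \<in> stiefel2"
  shows "hdot (column 1 A) (column 1 A) = 1" "hdot (column 2 A) (column 2 A) = 1"
    "hdot (column 1 A) (column 2 A) = 0" "hdot (column 2 A) (column 1 A) = 0"
  using assms hdot_commute[of "column 2 A" "column 1 A"] by (simp_all add: stiefel2_def)

lemma hdot_skew:
  fixes A :: "'k::conj_div_algebra ^ 2 ^ 'm"
  assumes "A \<in> stiefel2"
  shows "hdot (skew1 A k) (skew1 A k) = (1 + (norm k)\<^sup>2) *\<^sub>R 1"
    and "hdot (skew2 A k) (skew2 A k) = (1 + (norm k)\<^sup>2) *\<^sub>R 1"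
    and "hdot (skew1 A k) (skew2 A k) = 2 *\<^sub>R k"
  using stiefel2D[OF assms]
  by (simp_all add: skew1_def skew2_def hdot_simps hconj_mult_self hconj_mult_self' scaleR_add_left
      scaleR_2)

lemma norm_skew:
  assumes "A \<in> stiefel2"
  shows "(norm (skew1 A k))\<^sup>2 = 1 + (norm k)\<^sup>2" and "(norm (skew2 A k))\<^sup>2 = 1 + (norm k)\<^sup>2"
  using hdot_skew(1,2)[OF assms, of k] by (simp_all add: hdot_self)

lemma skew_nonzero:
  assumes "A \<in> stiefel2"
  shows "skew1 A k \<noteq> 0" and "skew2 A k \<noteq> 0"
proof -
  have "0 < 1 + (norm k)\<^sup>2" by (simp add: add_pos_nonneg)
  with norm_skew[OF assms, of k] show "skew1 A k \<noteq> 0" "skew2 A k \<noteq> 0"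
    by (metis less_irrefl norm_zero zero_power2)+
qed

lemma norm_rscale_sq: "(norm (rscale u c))\<^sup>2 = (norm u)\<^sup>2 * (norm c)\<^sup>2"
  for u :: "'k::conj_div_algebra ^ 'm"
proof -
  have "hdot (rscale u c) (rscale u c) = ((norm u)\<^sup>2 * (norm c)\<^sup>2) *\<^sub>R 1"
    by (simp add: hdot_rscale_left hdot_rscale_right hdot_self[of u] hconj_mult_self)
  then show ?thesis
    unfolding hdot_self[of "rscale u c"] by simp
qed

text \<open>Both vectors have squared norm \<open>1 + \<bar>k\<bar>\<^sup>2\<close>, so a proportionality factor would have norm \<open>1\<close>,
  and the inner product \<open>2 k\<close> would have norm \<open>1 + \<bar>k\<bar>\<^sup>2\<close>; that forces \<open>\<bar>k\<bar> = 1\<close>.\<close>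

lemma skew_noncollinear:
  assumes A: "A \<in> stiefel2" and k: "norm k < 1"
  shows "(skew1 A k, skew2 A k) \<in> noncollinear"
proof -
  have False if "skew2 A k = rscale (skew1 A k) c" for c
  proof -
    have pos: "0 < 1 + (norm k)\<^sup>2" by (simp add: add_pos_nonneg)
    have "(norm c)\<^sup>2 = 1"
      using norm_rscale_sq[of "skew1 A k" c] norm_skew[OF A, of k] that pos by simp
    then have c: "norm c = 1"
      by (simp add: abs_square_eq_1)
    have "2 *\<^sub>R k = (1 + (norm k)\<^sup>2) *\<^sub>R c"
      using hdot_skew(1,3)[OF A, of k] that by (simp add: hdot_simps)
    then have "norm (2 *\<^sub>R k) = norm ((1 + (norm k)\<^sup>2) *\<^sub>R c)" by simp
    then have "2 * norm k = 1 + (norm k)\<^sup>2"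
      using pos c by simp
    then have "(1 - norm k)\<^sup>2 = 0"
      by (simp add: power2_eq_square algebra_simps)
    with k show False by simp
  qed
  then show ?thesis
    using skew_nonzero[OF A] by (auto simp: noncollinear_def line_eq_iff)
qed

text \<open>Up to the factor \<open>1 - \<bar>k\<bar>\<^sup>2\<close>, the matrix with rows \<open>(1 -k)\<close> and \<open>(-hconj k 1)\<close> inverts the
  Hermitian matrix with rows \<open>(1 k)\<close> and \<open>(hconj k 1)\<close>.\<close>

lemma unskew:
  fixes A :: "'k::conj_div_algebra ^ 2 ^ 'm"
  shows "skew1 A k - rscale (skew2 A k) (hconj k) = (1 - (norm k)\<^sup>2) *\<^sub>R column 1 A"
    and "skew2 A k - rscale (skew1 A k) k = (1 - (norm k)\<^sup>2) *\<^sub>R column 2 A"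
  by (simp_all add: skew1_def skew2_def rscale_add_left rscale_rscale hconj_mult_self
      hconj_mult_self' rscale_scaleR_right rscale_1 scaleR_diff_left)

text \<open>The hypothesis on the products says that \<open>s / (1 + s\<^sup>2) = t / (1 + t\<^sup>2)\<close>. Up to the factor \<open>2\<close>
  this is the cosine of the angle between the two lines, which therefore determines the norm
  of the scalar.\<close>

lemma over_one_plus_square_inj:
  fixes s t :: real
  assumes "0 \<le> s" "s < 1" "0 \<le> t" "t < 1" "s * (1 + t\<^sup>2) = t * (1 + s\<^sup>2)"
  shows "s = t"
proof -
  have "(s - t) * (1 - s * t) = 0"
    using assms(5) by (simp add: algebra_simps power2_eq_square)
  moreover have "s * t < 1"
    using assms mult_left_le_one_le[of t s] by (simp add: mult.commute le_less_trans)
  ultimately show ?thesis by simp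
qed

text \<open>The inner products give \<open>l = hconj a * k * b\<close>, and the norms show first that \<open>a\<close> and \<open>b\<close>
  have equal norm and then, since the angle determines the norm of the scalar, that this norm
  is \<open>1\<close>. The frames can then be read off from \<open>unskew\<close>, and they differ by \<open>pdiag a b\<close>.\<close>

lemma skew_collinear_imp_bundle_rel:
  fixes A B :: "'k::conj_div_algebra ^ 2 ^ 'm"
  assumes A: "A \<in> stiefel2" "norm k < 1" and B: "B \<in> stiefel2" "norm l < 1"
    and x: "skew1 B l = rscale (skew1 A k) a" and y: "skew2 B l = rscale (skew2 A k) b"
  shows "((B, l), (A, k)) \<in> bundle_rel {k. norm k < 1}"
proof -
  have pos: "0 < 1 + (norm k)\<^sup>2" "0 < 1 + (norm l)\<^sup>2" by (simp_all add: add_pos_nonneg)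
  have 1: "1 + (norm l)\<^sup>2 = (1 + (norm k)\<^sup>2) * (norm a)\<^sup>2"
    "1 + (norm l)\<^sup>2 = (1 + (norm k)\<^sup>2) * (norm b)\<^sup>2"
    using norm_skew[OF A(1), of k] norm_skew[OF B(1), of l]
      norm_rscale_sq[of "skew1 A k" a] norm_rscale_sq[of "skew2 A k" b] by (simp_all add: x y)
  then have "(norm a)\<^sup>2 = (norm b)\<^sup>2" using pos by simp
  then have ab: "norm a = norm b" by simp
  have l: "l = hconj a * k * b"
    using hdot_skew(3)[OF B(1), of l] hdot_skew(3)[OF A(1), of k]
    by (simp add: x y hdot_simps)
  then have nl: "norm l = norm k * (norm a)\<^sup>2"
    by (simp add: norm_mult ab power2_eq_square)
  have "norm k * (1 + (norm l)\<^sup>2) = norm l * (1 + (norm k)\<^sup>2)"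
    unfolding 1(1) by (simp add: nl)
  then have kl: "norm k = norm l"
    by (rule over_one_plus_square_inj[OF norm_ge_zero A(2) norm_ge_zero B(2)])
  have "(1 + (norm l)\<^sup>2) * (norm a)\<^sup>2 = (1 + (norm l)\<^sup>2) * 1"
    using 1(1) by (simp only: kl mult_1_right)
  then have "(norm a)\<^sup>2 = 1"
    using pos(2) by (metis mult_left_cancel less_irrefl)
  then have a: "norm a = 1"
    by (simp add: abs_square_eq_1)
  with ab have b: "norm b = 1" by simp
  have k: "k = paction (pdiag a b) l"
  proof -
    have "a * (hconj a * k * b) * hconj b = (a * hconj a) * k * (b * hconj b)"
      by (simp only: mult.assoc)
    then show ?thesis by (simp add: paction_pdiag l hconj_mult_unit a b)
  qed
  have nz: "1 - (norm k)\<^sup>2 \<noteq> 0"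
    using A(2) by (simp add: abs_square_eq_1)
  have "(1 - (norm l)\<^sup>2) *\<^sub>R column 1 B = rscale (skew1 A k) a - rscale (rscale (skew2 A k) b) (hconj l)"
    using unskew(1)[of B l] by (simp add: x y)
  also have "\<dots> = rscale (skew1 A k - rscale (skew2 A k) (hconj k)) a"
  proof -
    have "b * hconj l = hconj k * a"
    proof -
      have "b * hconj l = (b * hconj b) * hconj k * a"
        by (simp add: l hconj_mult mult.assoc)
      then show ?thesis by (simp add: hconj_mult_unit b)
    qed
    then show ?thesis by (simp add: rscale_rscale rscale_diff_left)
  qed
  also have "\<dots> = (1 - (norm k)\<^sup>2) *\<^sub>R rscale (column 1 A) a"
    by (simp add: unskew rscale_scaleR_left)
  finally have c1: "column 1 B = rscale (column 1 A) a"
    using nz by (simp add: kl)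
  have "(1 - (norm l)\<^sup>2) *\<^sub>R column 2 B = rscale (skew2 A k) b - rscale (rscale (skew1 A k) a) l"
    using unskew(2)[of B l] by (simp add: x y)
  also have "\<dots> = rscale (skew2 A k - rscale (skew1 A k) k) b"
  proof -
    have "a * l = k * b"
    proof -
      have "a * l = (a * hconj a) * k * b"
        by (simp add: l mult.assoc)
      then show ?thesis by (simp add: hconj_mult_unit a)
    qed
    then show ?thesis by (simp add: rscale_rscale rscale_diff_left)
  qed
  also have "\<dots> = (1 - (norm k)\<^sup>2) *\<^sub>R rscale (column 2 A) b"
    by (simp add: unskew rscale_scaleR_left)
  finally have c2: "column 2 B = rscale (column 2 A) b"
    using nz by (simp add: kl)
  have "B = A ** pdiag a b"
    by (simp add: frame_eq_iff frame_mult_pgroup c1 c2)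
  then show ?thesis
    using A(1) B(2) a b k pdiag_pgroup[OF a b] unfolding bundle_rel_def by blast
qed

lemma equiv_disc_bundle_rel:
  "equiv (stiefel2 \<times> {k. norm k < 1})
    (bundle_rel {k. norm k < 1} :: ((('k::conj_div_algebra ^ 2 ^ 'm) \<times> 'k) \<times> (('k ^ 2 ^ 'm) \<times> 'k)) set)"
  by (rule equiv_bundle_rel) (simp add: norm_paction)

text \<open>Two ordered pairs with the same unordered pair of lines agree line by line, or do so after
  one of them is swapped; multiplying the frame by \<open>ptau\<close> and conjugating the scalar performs
  the swap within one class of the disc bundle.\<close>

lemma line_pair_skew_eq_iff:
  fixes A B :: "'k::conj_div_algebra ^ 2 ^ 'm"
  assumes A: "A \<in> stiefel2" "norm k < 1" and B: "B \<in> stiefel2" "norm l < 1"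
  shows "line_pair (skew1 A k, skew2 A k) = line_pair (skew1 B l, skew2 B l) \<longleftrightarrow>
    ((A, k), (B, l)) \<in> bundle_rel {k. norm k < 1}" (is "?L \<longleftrightarrow> ?R")
proof
  assume ?R
  then obtain g where g: "g \<in> pgroup" "A = B ** g" "l = paction g k"
    unfolding bundle_rel_def by blast
  note nz = skew_nonzero[OF A(1), of k] skew_nonzero[OF B(1), of l]
  show ?L
    using g(1)
  proof (cases rule: pgroupE)
    case (1 a b)
    then have "a \<noteq> 0" "b \<noteq> 0" by auto
    then show ?thesis
      using nz skew_pdiag[OF 1(1,2), of B k] by (simp add: g 1 line_pair_eq_iff line_rscale rscale_eq_0_iff)
  next
    case (2 a b)
    then have "a \<noteq> 0" "b \<noteq> 0" by auto
    then show ?thesis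
      using nz skew_panti[OF 2(1,2), of B k] by (simp add: g 2 line_pair_eq_iff line_rscale rscale_eq_0_iff)
  qed
next
  let ?r = "bundle_rel {k :: 'k. norm k < 1} :: ((('k ^ 2 ^ 'm) \<times> 'k) \<times> (('k ^ 2 ^ 'm) \<times> 'k)) set"
  have sym: "sym ?r" and trans: "trans ?r"
    using equiv_disc_bundle_rel by (auto simp: equiv_def)
  assume ?L
  then consider a b where "skew1 B l = rscale (skew1 A k) a" "skew2 B l = rscale (skew2 A k) b"
    | a b where "skew1 B l = rscale (skew2 A k) a" "skew2 B l = rscale (skew1 A k) b"
    using skew_nonzero[OF A(1), of k] skew_nonzero[OF B(1), of l]
    by (auto simp: line_pair_eq_iff line_eq_iff)
  then have "((B, l), (A, k)) \<in> ?r"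
  proof cases
    case 1
    then show ?thesis using A B by (intro skew_collinear_imp_bundle_rel)
  next
    case 2
    \<comment> \<open>The frame \<open>?A\<close> with the conjugate scalar skews to the same two vectors in the other order.\<close>
    let ?A = "A ** ptau"
    have tau: "ptau \<in> pgroup" by (simp add: ptau_def panti_pgroup)
    have "skew1 ?A (hconj k) = skew2 A k" "skew2 ?A (hconj k) = skew1 A k"
      using skew_panti[of 1 1 A "hconj k"] paction_ptau[of "hconj k"]
      by (simp_all add: ptau_def rscale_1)
    with 2 have "((B, l), (?A, hconj k)) \<in> ?r"
      using A B stiefel2_mult[OF A(1) tau] by (intro skew_collinear_imp_bundle_rel) simp_all
    moreover have "((?A, hconj k), (A, k)) \<in> ?r"
    proof -
      have "hconj k \<in> {k. norm k < 1}" using A(2) by simp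
      then have "((?A, hconj k), (A, paction ptau (hconj k))) \<in> ?r"
        unfolding bundle_rel_def using A(1) tau by blast
      then show ?thesis by (simp add: paction_ptau)
    qed
    ultimately show ?thesis
      by (rule transD[OF trans])
  qed
  then show ?R
    by (rule symD[OF sym])
qed

section \<open>Recovering the frame from a pair of vectors\<close>

text \<open>For real \<open>c = sin \<phi>\<close> with \<open>\<bar>\<phi>\<bar> < \<pi> / 2\<close> this is \<open>tan (\<phi> / 2)\<close>: it inverts \<open>k \<mapsto> 2 k / (1 + \<bar>k\<bar>\<^sup>2)\<close>, which takes the
  scalar to the normalized inner product of the skewed vectors.\<close>

definition half_angle :: "'k::conj_div_algebra \<Rightarrow> 'k" where
  "half_angle c = c /\<^sub>R (1 + sqrt (1 - (norm c)\<^sup>2))"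

lemma half_angle:
  fixes c :: "'k::conj_div_algebra"
  assumes c: "norm c < 1"
  shows "norm (half_angle c) < 1"
    and "(1 + (norm (half_angle c))\<^sup>2) *\<^sub>R c = 2 *\<^sub>R half_angle c"
proof -
  define r where "r = sqrt (1 - (norm c)\<^sup>2)"
  have c2: "(norm c)\<^sup>2 < 1" using c by (simp add: abs_square_less_1)
  then have r: "0 < r" "r\<^sup>2 = 1 - (norm c)\<^sup>2" by (simp_all add: r_def)
  have n: "norm (half_angle c) = norm c / (1 + r)"
    using r(1) by (simp add: half_angle_def r_def[symmetric] divide_inverse mult.commute)
  show "norm (half_angle c) < 1"
    using c r(1) by (simp add: n divide_less_eq)
  have "(norm c)\<^sup>2 = (1 - r) * (1 + r)"
    using r(2) by (simp add: power2_eq_square algebra_simps)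
  then have "(norm (half_angle c))\<^sup>2 = (1 - r) / (1 + r)"
    using r(1) by (simp add: n power_divide power2_eq_square)
  then have "1 + (norm (half_angle c))\<^sup>2 = 2 * inverse (1 + r)"
    using r(1) by (simp add: field_simps)
  then show "(1 + (norm (half_angle c))\<^sup>2) *\<^sub>R c = 2 *\<^sub>R half_angle c"
    by (simp add: half_angle_def r_def[symmetric])
qed

text \<open>The factor \<open>\<beta>\<close> normalizes the two columns: for unit vectors \<open>x\<close>, \<open>y\<close> with
  \<open>(1 + \<bar>k\<bar>\<^sup>2) hdot x y = 2 k\<close>, both \<open>x - y k\<^sup>*\<close> and \<open>y - x k\<close> have squared norm
  \<open>(1 - \<bar>k\<bar>\<^sup>2)\<^sup>2 / (1 + \<bar>k\<bar>\<^sup>2)\<close>.\<close>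

definition straighten :: "'k::conj_div_algebra ^ 'm \<Rightarrow> 'k ^ 'm \<Rightarrow> ('k ^ 2 ^ 'm) \<times> 'k" where
  "straighten x y = (let k = half_angle (hdot x y); \<beta> = sqrt (1 + (norm k)\<^sup>2) / (1 - (norm k)\<^sup>2) in
     (frame (\<beta> *\<^sub>R (x - rscale y (hconj k))) (\<beta> *\<^sub>R (y - rscale x k)), k))"

text \<open>The defining property of \<open>k\<close> makes the two columns orthogonal, because the inner product
  of \<open>x - y k\<^sup>*\<close> and \<open>y - x k\<close> is \<open>c - 2 k + k c\<^sup>* k\<close> with \<open>c = hdot x y\<close>. Skewing the result returns
  \<open>x\<close> and \<open>y\<close> up to one common real factor, so the lines are unchanged.\<close>

lemma straighten:
  fixes x y :: "'k::conj_div_algebra ^ 'm"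
  assumes x: "norm x = 1" and y: "norm y = 1" and c: "norm (hdot x y) < 1"
    and Ak: "straighten x y = (A, k)"
  shows "A \<in> stiefel2" "norm k < 1"
    "\<exists>s. s \<noteq> 0 \<and> skew1 A k = s *\<^sub>R x \<and> skew2 A k = s *\<^sub>R y"
proof -
  define \<kappa> where "\<kappa> = (norm k)\<^sup>2"
  define \<beta> where "\<beta> = sqrt (1 + \<kappa>) / (1 - \<kappa>)"
  have k: "k = half_angle (hdot x y)"
    and A: "column 1 A = \<beta> *\<^sub>R (x - rscale y (hconj k))" "column 2 A = \<beta> *\<^sub>R (y - rscale x k)"
    using Ak by (auto simp: straighten_def Let_def \<beta>_def \<kappa>_def)
  show k1: "norm k < 1"
    using half_angle(1)[OF c] by (simp add: k)
  have \<kappa>: "0 \<le> \<kappa>" "\<kappa> < 1"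
    using k1 by (simp_all add: \<kappa>_def abs_square_less_1)
  have \<beta>: "\<beta>\<^sup>2 * ((1 - \<kappa>)\<^sup>2 / (1 + \<kappa>)) = 1" "\<beta> > 0"
    using \<kappa> by (simp_all add: \<beta>_def power_divide)
  have xx: "hdot x x = 1" and yy: "hdot y y = 1"
    using x y by (simp_all add: hdot_self)
  define \<alpha> where "\<alpha> = 2 / (1 + \<kappa>)"
  have xy: "hdot x y = \<alpha> *\<^sub>R k"
  proof -
    have "(2 / (1 + \<kappa>)) *\<^sub>R k = (1 / (1 + \<kappa>)) *\<^sub>R (2 *\<^sub>R k)" by simp
    also have "2 *\<^sub>R k = (1 + \<kappa>) *\<^sub>R hdot x y"
      using half_angle(2)[OF c] by (simp add: k \<kappa>_def)
    also have "(1 / (1 + \<kappa>)) *\<^sub>R \<dots> = hdot x y"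
      using \<kappa> by simp
    finally show ?thesis by (simp add: \<alpha>_def)
  qed
  have yx: "hdot y x = \<alpha> *\<^sub>R hconj k"
    using xy by (simp add: hdot_commute[of y x] hconj_scaleR)
  have kk: "k * hconj k = \<kappa> *\<^sub>R 1" "hconj k * k = \<kappa> *\<^sub>R 1"
    by (simp_all add: \<kappa>_def hconj_mult_self hconj_mult_self')
  have kkk: "k * (hconj k * k) = \<kappa> *\<^sub>R k"
    by (simp add: kk)
  have sq_norm: "1 - \<alpha> * \<kappa> - (\<alpha> * \<kappa> - \<kappa>) = (1 - \<kappa>)\<^sup>2 / (1 + \<kappa>)"
    using \<kappa> by (simp add: \<alpha>_def divide_simps) (simp add: power2_eq_square algebra_simps)
  have orth: "\<alpha> - 1 - (1 - \<alpha> * \<kappa>) = 0"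
    using \<kappa> by (simp add: \<alpha>_def field_simps)
  have "hdot (x - rscale y (hconj k)) (x - rscale y (hconj k)) =
      1 - (\<alpha> * \<kappa>) *\<^sub>R 1 - ((\<alpha> * \<kappa>) *\<^sub>R 1 - \<kappa> *\<^sub>R 1)"
    by (simp add: hdot_simps xx yy xy yx kk left_diff_distrib right_diff_distrib)
  then have 1: "hdot (x - rscale y (hconj k)) (x - rscale y (hconj k)) = ((1 - \<kappa>)\<^sup>2 / (1 + \<kappa>)) *\<^sub>R 1"
    by (simp only: scaleR_diff_left scaleR_one flip: sq_norm)
  have "hdot (y - rscale x k) (y - rscale x k) =
      1 - (\<alpha> * \<kappa>) *\<^sub>R 1 - ((\<alpha> * \<kappa>) *\<^sub>R 1 - \<kappa> *\<^sub>R 1)"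
    by (simp add: hdot_simps xx yy xy yx kk left_diff_distrib right_diff_distrib)
  then have 2: "hdot (y - rscale x k) (y - rscale x k) = ((1 - \<kappa>)\<^sup>2 / (1 + \<kappa>)) *\<^sub>R 1"
    by (simp only: scaleR_diff_left scaleR_one flip: sq_norm)
  have "hdot (x - rscale y (hconj k)) (y - rscale x k) =
      \<alpha> *\<^sub>R k - k - (k - (\<alpha> * \<kappa>) *\<^sub>R k)"
    by (simp add: hdot_simps xx yy xy yx kkk mult.assoc left_diff_distrib right_diff_distrib)
  also have "\<dots> = (\<alpha> - 1 - (1 - \<alpha> * \<kappa>)) *\<^sub>R k"
    by (simp only: scaleR_diff_left scaleR_one)
  finally have 3: "hdot (x - rscale y (hconj k)) (y - rscale x k) = 0"
    unfolding orth by simp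
  have scaled: "\<beta> *\<^sub>R \<beta> *\<^sub>R ((1 - \<kappa>)\<^sup>2 / (1 + \<kappa>)) *\<^sub>R 1 = (1 :: 'k)"
    using \<beta>(1) by (simp only: scaleR_scaleR power2_eq_square[of \<beta>] mult.assoc scaleR_one)
  show "A \<in> stiefel2"
    by (simp only: scaled stiefel2_def A hdot_scaleR_left hdot_scaleR_right 1 2 3 scaleR_zero_right
        mem_Collect_eq simp_thms)
  have "skew1 A k = (\<beta> * (1 - \<kappa>)) *\<^sub>R x" "skew2 A k = (\<beta> * (1 - \<kappa>)) *\<^sub>R y"
    by (simp_all add: skew1_def skew2_def A rscale_scaleR_left rscale_diff_left rscale_rscale kk
        rscale_scaleR_right rscale_1 algebra_simps)
  then show "\<exists>s. s \<noteq> 0 \<and> skew1 A k = s *\<^sub>R x \<and> skew2 A k = s *\<^sub>R y"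
    using \<beta>(2) \<kappa> by (intro exI[of _ "\<beta> * (1 - \<kappa>)"]) simp
qed

lemma continuous_on_half_angle:
  "continuous_on {c :: 'k::conj_div_algebra. norm c < 1} half_angle"
proof -
  have "1 + sqrt (1 - (norm c)\<^sup>2) \<noteq> 0" if "norm c < 1" for c :: 'k
  proof -
    have "0 \<le> sqrt (1 - (norm c)\<^sup>2)"
      using that by (simp add: abs_square_le_1)
    then show ?thesis by linarith
  qed
  then show ?thesis
    unfolding half_angle_def by (auto intro!: continuous_intros)
qed

lemma continuous_on_straighten:
  "continuous_on {(x, y). norm (hdot x y :: 'k::conj_div_algebra) < 1}
     (\<lambda>(x :: 'k ^ 'm, y). straighten x y)"
proof -
  let ?S = "{p :: ('k ^ 'm) \<times> ('k ^ 'm). norm (hdot (fst p) (snd p)) < 1}"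
  have k: "continuous_on ?S (\<lambda>p. half_angle (hdot (fst p) (snd p)))"
    by (rule continuous_on_compose2[OF continuous_on_half_angle]) (auto intro!: continuous_intros)
  have nz: "1 - (norm (half_angle (hdot (fst p) (snd p))))\<^sup>2 \<noteq> 0" if "p \<in> ?S" for p
    using half_angle(1)[of "hdot (fst p) (snd p)"] that by (simp add: abs_square_eq_1)
  have "continuous_on ?S (\<lambda>p. straighten (fst p) (snd p))"
    unfolding straighten_def Let_def by (intro continuous_intros k ballI nz)
  then show ?thesis
    by (simp add: case_prod_unfold)
qed

text \<open>The strict Cauchy-Schwarz inequality: for unit vectors, \<open>y - x c\<close>, with \<open>c = hdot x y\<close>, has squared norm
  \<open>1 - \<bar>c\<bar>\<^sup>2\<close>, and it does not vanish when the lines are distinct.\<close>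

lemma norm_hdot_less_one:
  fixes x y :: "'k::conj_div_algebra ^ 'm"
  assumes x: "norm x = 1" and y: "norm y = 1" and xy: "(x, y) \<in> noncollinear"
  shows "norm (hdot x y) < 1"
proof -
  define c where "c = hdot x y"
  have "hdot x x = 1" "hdot y y = 1" "hdot y x = hconj c"
    using x y by (simp_all add: hdot_self c_def hdot_commute[of y x])
  then have "hdot (y - rscale x c) (y - rscale x c) = (1 - (norm c)\<^sup>2) *\<^sub>R 1"
    by (simp add: hdot_simps c_def[symmetric] hconj_mult_self scaleR_diff_left)
  then have c: "(norm (y - rscale x c))\<^sup>2 = 1 - (norm c)\<^sup>2"
    by (simp add: hdot_self)
  have "y \<noteq> rscale x c"
  proof
    assume eq: "y = rscale x c"
    with xy have "c \<noteq> 0" by (auto simp: noncollinear_def rscale_eq_0_iff)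
    with xy line_rscale[of x c] show False by (auto simp: noncollinear_def eq)
  qed
  then have "0 < (norm (y - rscale x c))\<^sup>2" by simp
  with c show ?thesis
    by (simp add: c_def abs_square_less_1)
qed

section \<open>The homeomorphism with the disc bundle\<close>

text \<open>Normalizing and straightening is a continuous map \<open>\<Psi>\<close> in the opposite direction that does not change
  the pair of lines, so the map composed with \<open>\<Psi>\<close> is the quotient map \<open>line_pair\<close>. A
  continuous map is a quotient map as soon as it becomes one after such a precomposition.\<close>

lemma quotient_map_line_pair_skew:
  "quotient_map (top_of_set (stiefel2 \<times> {k. norm k < 1})) (conf2 proj_space)
     (\<lambda>(A :: 'k::conj_div_algebra ^ 2 ^ 'm, k). line_pair (skew1 A k, skew2 A k))"
proof -
  let ?E = "stiefel2 \<times> {k. norm k < 1} :: (('k ^ 2 ^ 'm) \<times> 'k) set"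
  let ?W = "noncollinear :: (('k ^ 'm) \<times> ('k ^ 'm)) set"
  define \<Psi> where "\<Psi> = (\<lambda>(x :: 'k ^ 'm, y :: 'k ^ 'm). straighten (sgn x) (sgn y))"
  define \<Phi> where "\<Phi> = (\<lambda>(A :: 'k ^ 2 ^ 'm, k). (skew1 A k, skew2 A k))"
  have sgn: "sgn x = (1 / norm x) *\<^sub>R x" for x :: "'k ^ 'm"
    by (simp add: sgn_div_norm divide_inverse)
  have W: "norm (sgn x) = 1" "norm (sgn y) = 1" "norm (hdot (sgn x) (sgn y)) < 1"
    if "(x, y) \<in> ?W" for x y
  proof -
    have nz: "x \<noteq> 0" "y \<noteq> 0" using that by (auto simp: noncollinear_def)
    then show n: "norm (sgn x) = 1" "norm (sgn y) = 1" by (simp_all add: norm_sgn)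
    have "(sgn x, sgn y) \<in> ?W"
      using that nz by (simp add: noncollinear_def sgn line_scaleR)
    with n show "norm (hdot (sgn x) (sgn y)) < 1"
      by (rule norm_hdot_less_one)
  qed
  have \<Psi>E: "\<Psi> p \<in> ?E" and \<Phi>\<Psi>: "line_pair (\<Phi> (\<Psi> p)) = line_pair p" if "p \<in> ?W" for p
  proof -
    obtain x y where p: "p = (x, y)" by (cases p)
    obtain A k where Ak: "straighten (sgn x) (sgn y) = (A, k)" by (cases "straighten (sgn x) (sgn y)")
    note w = W[OF that[unfolded p]]
    from straighten[OF w Ak] obtain s where s: "A \<in> stiefel2" "norm k < 1"
      "s \<noteq> 0" "skew1 A k = s *\<^sub>R sgn x" "skew2 A k = s *\<^sub>R sgn y" by blast
    show "\<Psi> p \<in> ?E" using s by (simp add: \<Psi>_def p Ak)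
    have nz: "x \<noteq> 0" "y \<noteq> 0" using that by (auto simp: noncollinear_def p)
    have "line_rel `` {s *\<^sub>R sgn z} = line_rel `` {z}" if "z \<noteq> 0" for z :: "'k ^ 'm"
      using that s(3) line_scaleR[of z "s / norm z"] by (simp add: sgn)
    with nz s show "line_pair (\<Phi> (\<Psi> p)) = line_pair p"
      by (simp add: \<Psi>_def \<Phi>_def p Ak line_pair_def)
  qed
  have "continuous_on ?W (\<lambda>p. (\<lambda>(x, y). straighten x y) (sgn (fst p), sgn (snd p)))"
  proof (rule continuous_on_compose2[OF continuous_on_straighten])
    show "continuous_on ?W (\<lambda>p. (sgn (fst p), sgn (snd p)))"
      by (intro continuous_intros) (auto simp: noncollinear_def)
  qed (use W in auto)
  then have "continuous_on ?W \<Psi>"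
    by (simp add: \<Psi>_def case_prod_unfold)
  then have \<Psi>: "continuous_map (top_of_set ?W) (top_of_set ?E) \<Psi>"
    using \<Psi>E by (auto simp: continuous_map_in_subtopology)
  have "continuous_on ?E \<Phi>"
    unfolding \<Phi>_def case_prod_unfold skew1_def skew2_def by (intro continuous_intros)
  then have "continuous_map (top_of_set ?E) (top_of_set ?W) \<Phi>"
    using skew_noncollinear by (auto simp: continuous_map_in_subtopology \<Phi>_def)
  then have cont: "continuous_map (top_of_set ?E) (conf2 proj_space) (line_pair \<circ> \<Phi>)"
    by (rule continuous_map_compose[OF _ quotient_imp_continuous_map[OF quotient_map_line_pair]])
  have "quotient_map (top_of_set ?W) (conf2 proj_space) ((line_pair \<circ> \<Phi>) \<circ> \<Psi>)"
    by (rule quotient_map_eq[OF quotient_map_line_pair]) (simp add: \<Phi>\<Psi>)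
  then have "quotient_map (top_of_set ?E) (conf2 proj_space) (line_pair \<circ> \<Phi>)"
    by (rule quotient_map_from_composition[OF \<Psi> cont])
  then show ?thesis
    by (simp add: \<Phi>_def comp_def case_prod_unfold)
qed

lemma quotient_map_disc_bundle:
  "quotient_map (top_of_set (stiefel2 \<times> {k. norm k < 1}))
     (open_disc_bundle :: (('k::conj_div_algebra ^ 2 ^ 'm) \<times> 'k) set topology)
     (\<lambda>p. bundle_rel {k. norm k < 1} `` {p})"
  using quotient_map_quotient_space unfolding open_disc_bundle_def assoc_bundle_def
  by (metis prod_topology_subtopology_eu)

theorem conf2_proj_space_homeomorphic_disc_bundle:
  "conf2 (proj_space :: ('k::conj_div_algebra ^ 'm) set topology) homeomorphic_space
     (open_disc_bundle :: (('k ^ 2 ^ 'm) \<times> 'k) set topology)"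
proof (rule homeomorphic_space_of_quotient_maps[OF quotient_map_line_pair_skew quotient_map_disc_bundle])
  fix p q :: "('k ^ 2 ^ 'm) \<times> 'k"
  obtain A k B l where pq: "p = (A, k)" "q = (B, l)" by (cases p; cases q)
  assume "p \<in> topspace (top_of_set (stiefel2 \<times> {k. norm k < 1}))"
    "q \<in> topspace (top_of_set (stiefel2 \<times> {k. norm k < 1}))"
  then show "(case p of (A, k) \<Rightarrow> line_pair (skew1 A k, skew2 A k)) =
      (case q of (A, k) \<Rightarrow> line_pair (skew1 A k, skew2 A k)) \<longleftrightarrow>
      bundle_rel {k. norm k < 1} `` {p} = bundle_rel {k. norm k < 1} `` {q}"
    by (simp add: pq line_pair_skew_eq_iff eq_equiv_class_iff[OF equiv_disc_bundle_rel])
qed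

section \<open>Retracting the disc bundle onto its base\<close>

lemma paction_scaleR: "paction g (t *\<^sub>R k) = t *\<^sub>R paction g k"
  by (simp add: paction_def hconj_scaleR)

text \<open>The bundle projection \<open>p\<close>, the zero section \<open>s\<close> and the shrinking homotopy \<open>h\<close> are all
  obtained by descending maps from \<open>stiefel2 \<times> F\<close> to the quotients, with \<open>F\<close> the open disc.
  For \<open>h\<close> this needs that the quotient map stays a quotient map after taking the product
  with the unit interval, which holds because the interval is locally compact and Hausdorff.\<close>

theorem disc_bundle_homotopy_equivalent_base:
  "(open_disc_bundle :: (('k::conj_div_algebra ^ 2 ^ 'm) \<times> 'k) set topology)
     homotopy_equivalent_space (Gamma_space :: ('k ^ 2 ^ 'm) set topology)"
proof -
  let ?F = "{k :: 'k. norm k < 1}"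
  let ?E = "stiefel2 \<times> ?F :: (('k ^ 2 ^ 'm) \<times> 'k) set"
  let ?D = "open_disc_bundle :: (('k ^ 2 ^ 'm) \<times> 'k) set topology"
  let ?G = "Gamma_space :: ('k ^ 2 ^ 'm) set topology"
  define \<pi> where "\<pi> = (\<lambda>p :: ('k ^ 2 ^ 'm) \<times> 'k. bundle_rel ?F `` {p})"
  define \<gamma> where "\<gamma> = (\<lambda>A :: 'k ^ 2 ^ 'm. frame_rel `` {A})"
  have \<pi>: "quotient_map (top_of_set ?E) ?D \<pi>"
    unfolding \<pi>_def by (rule quotient_map_disc_bundle)
  have \<gamma>: "quotient_map (top_of_set stiefel2) ?G \<gamma>"
    unfolding \<gamma>_def Gamma_space_def by (rule quotient_map_quotient_space)
  have \<pi>_eq: "\<pi> p = \<pi> q \<longleftrightarrow> (p, q) \<in> bundle_rel ?F" if "p \<in> ?E" "q \<in> ?E" for p q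
    using eq_equiv_class_iff[OF equiv_disc_bundle_rel] that unfolding \<pi>_def by blast
  have \<gamma>_eq: "\<gamma> A = \<gamma> B \<longleftrightarrow> (A, B) \<in> frame_rel" if "A \<in> stiefel2" "B \<in> stiefel2" for A B
    using eq_equiv_class_iff[OF equiv_frame_rel] that unfolding \<gamma>_def by blast
  have shrink: "((A, t *\<^sub>R k), (B, t *\<^sub>R l)) \<in> bundle_rel ?F"
    if r: "((A, k), (B, l)) \<in> bundle_rel ?F" and t: "t \<in> {0..1}" for A B :: "'k ^ 2 ^ 'm" and k l and t :: real
  proof -
    obtain g where g: "B \<in> stiefel2" "g \<in> pgroup" "k \<in> ?F" "A = B ** g" "l = paction g k"
      using r unfolding bundle_rel_def by blast
    have "norm (t *\<^sub>R k) \<le> norm k"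
      using t by (simp add: mult_left_le_one_le)
    with g(3) have "t *\<^sub>R k \<in> ?F" by simp
    with g show ?thesis
      unfolding bundle_rel_def by (auto simp: paction_scaleR)
  qed
  have forget: "(A, B) \<in> frame_rel" if "((A, k), (B, l)) \<in> bundle_rel ?F" for A B :: "'k ^ 2 ^ 'm" and k l
  proof -
    have "(B, A) \<in> frame_rel"
      using that unfolding bundle_rel_def frame_rel_def by blast
    then show ?thesis
      using equiv_frame_rel unfolding equiv_def by (meson symD)
  qed
  have zero: "((A, 0), (B, 0)) \<in> bundle_rel ?F" if "(A, B) \<in> frame_rel" for A B :: "'k ^ 2 ^ 'm"
  proof -
    have "(B, A) \<in> frame_rel"
      using that equiv_frame_rel unfolding equiv_def by (meson symD)
    then obtain g where g: "B \<in> stiefel2" "g \<in> pgroup" "A = B ** g"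
      by (auto simp: frame_rel_def)
    have "paction g 0 = 0" by (simp add: paction_def)
    with g show ?thesis unfolding bundle_rel_def by force
  qed

  obtain p where p: "continuous_map ?D ?G p" "\<And>A k. (A, k) \<in> ?E \<Longrightarrow> p (\<pi> (A, k)) = \<gamma> A"
  proof -
    have "continuous_map (top_of_set ?E) (top_of_set stiefel2) fst"
      by (auto simp: continuous_map_in_subtopology intro!: continuous_intros)
    then have c: "continuous_map (top_of_set ?E) ?G (\<gamma> \<circ> fst)"
      by (rule continuous_map_compose[OF _ quotient_imp_continuous_map[OF \<gamma>]])
    obtain p where "continuous_map ?D ?G p" "\<And>x. x \<in> topspace (top_of_set ?E) \<Longrightarrow> p (\<pi> x) = (\<gamma> \<circ> fst) x"
    proof (rule quotient_map_lift_exists[OF \<pi> c])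
      show "(\<gamma> \<circ> fst) x = (\<gamma> \<circ> fst) y"
        if "x \<in> topspace (top_of_set ?E)" "y \<in> topspace (top_of_set ?E)" "\<pi> x = \<pi> y" for x y
        using that \<pi>_eq forget by (cases x; cases y) (auto simp: \<gamma>_eq)
    qed (rule that, auto)
    then show ?thesis by (intro that[of p]) auto
  qed
  obtain s where s: "continuous_map ?G ?D s" "\<And>A. A \<in> stiefel2 \<Longrightarrow> s (\<gamma> A) = \<pi> (A, 0)"
  proof -
    have "continuous_map (top_of_set stiefel2) (top_of_set ?E) (\<lambda>A. (A, 0))"
      by (auto simp: continuous_map_in_subtopology intro!: continuous_intros)
    then have c: "continuous_map (top_of_set stiefel2) ?D (\<pi> \<circ> (\<lambda>A. (A, 0)))"
      by (rule continuous_map_compose[OF _ quotient_imp_continuous_map[OF \<pi>]])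
    obtain s where "continuous_map ?G ?D s"
      "\<And>x. x \<in> topspace (top_of_set stiefel2) \<Longrightarrow> s (\<gamma> x) = (\<pi> \<circ> (\<lambda>A. (A, 0))) x"
    proof (rule quotient_map_lift_exists[OF \<gamma> c])
      show "(\<pi> \<circ> (\<lambda>A. (A, 0))) x = (\<pi> \<circ> (\<lambda>A. (A, 0))) y"
        if "x \<in> topspace (top_of_set stiefel2)" "y \<in> topspace (top_of_set stiefel2)" "\<gamma> x = \<gamma> y" for x y
        using that zero by (auto simp: \<gamma>_eq \<pi>_eq)
    qed (rule that, auto)
    then show ?thesis by (intro that[of s]) auto
  qed
  let ?I = "top_of_set {0..1::real}"
  have q: "quotient_map (prod_topology ?I (top_of_set ?E)) (prod_topology ?I ?D) (\<lambda>(t, x). (t, \<pi> x))"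
  proof (rule quotient_map_prod_right[OF _ _ \<pi>])
    show "locally_compact_space ?I"
      by (simp add: compact_imp_locally_compact_space compact_space_subtopology)
    show "Hausdorff_space ?I \<or> regular_space ?I"
      by (simp add: Hausdorff_space_subtopology)
  qed
  have scale: "continuous_map (prod_topology ?I (top_of_set ?E)) (top_of_set ?E)
      (\<lambda>(t, A, k). (A, t *\<^sub>R k))"
  proof -
    have "norm (t *\<^sub>R k) < 1" if "0 \<le> t" "t \<le> 1" "norm k < 1" for t and k :: 'k
      using that mult_left_le_one_le[of "norm k" t] by simp
    then show ?thesis
      by (auto simp: continuous_map_in_subtopology case_prod_unfold intro!: continuous_intros)
  qed
  have c: "continuous_map (prod_topology ?I (top_of_set ?E)) ?D (\<pi> \<circ> (\<lambda>(t, A, k). (A, t *\<^sub>R k)))"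
    by (rule continuous_map_compose[OF scale quotient_imp_continuous_map[OF \<pi>]])
  obtain h where h: "continuous_map (prod_topology ?I ?D) ?D h"
    "\<And>t A k. t \<in> {0..1} \<Longrightarrow> (A, k) \<in> ?E \<Longrightarrow> h (t, \<pi> (A, k)) = \<pi> (A, t *\<^sub>R k)"
  proof -
    obtain h where "continuous_map (prod_topology ?I ?D) ?D h"
      "\<And>x. x \<in> topspace (prod_topology ?I (top_of_set ?E)) \<Longrightarrow>
        h ((\<lambda>(t, x). (t, \<pi> x)) x) = (\<pi> \<circ> (\<lambda>(t, A, k). (A, t *\<^sub>R k))) x"
    proof (rule quotient_map_lift_exists[OF q c])
      fix x y
      assume xy: "x \<in> topspace (prod_topology ?I (top_of_set ?E))"
        "y \<in> topspace (prod_topology ?I (top_of_set ?E))"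
        "(\<lambda>(t, x). (t, \<pi> x)) x = (\<lambda>(t, x). (t, \<pi> x)) y"
      obtain t A k l B where x: "x = (t, A, k)" and y: "y = (t, B, l)"
        using xy(3) by (cases x; cases y) auto
      have E: "(A, k) \<in> ?E" "(B, l) \<in> ?E" "t \<in> {0..1}" using xy by (auto simp: x y)
      then have "((A, k), (B, l)) \<in> bundle_rel ?F"
        using xy(3) \<pi>_eq by (simp add: x y)
      from shrink[OF this E(3)] have r: "((A, t *\<^sub>R k), (B, t *\<^sub>R l)) \<in> bundle_rel ?F" .
      have "(A, t *\<^sub>R k) \<in> ?E" "(B, t *\<^sub>R l) \<in> ?E"
        using subsetD[OF equiv_type[OF equiv_disc_bundle_rel] r] by simp_all
      with r show "(\<pi> \<circ> (\<lambda>(t, A, k). (A, t *\<^sub>R k))) x = (\<pi> \<circ> (\<lambda>(t, A, k). (A, t *\<^sub>R k))) y"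
        by (simp add: x y \<pi>_eq)
    qed (rule that, auto)
    then show ?thesis by (intro that[of h]) auto
  qed
  have D: "\<exists>A k. (A, k) \<in> ?E \<and> x = \<pi> (A, k)" if "x \<in> topspace ?D" for x
  proof -
    have "x \<in> \<pi> ` ?E"
      using that quotient_imp_surjective_map[OF \<pi>] by simp
    then obtain q where "q \<in> ?E" "x = \<pi> q" by (rule imageE)
    then show ?thesis by (cases q) (intro exI[of _ "fst q"] exI[of _ "snd q"], simp)
  qed
  have G: "\<exists>A. A \<in> stiefel2 \<and> x = \<gamma> A" if "x \<in> topspace ?G" for x
  proof -
    have "x \<in> \<gamma> ` stiefel2"
      using that quotient_imp_surjective_map[OF \<gamma>] by simp
    then show ?thesis by blast
  qed
  have sp: "h (0, x) = (s \<circ> p) x" "h (1, x) = x" if x_in: "x \<in> topspace ?D" for x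
  proof -
    obtain A k where x: "(A, k) \<in> ?E" "x = \<pi> (A, k)" using D[OF x_in] by blast
    then show "h (0, x) = (s \<circ> p) x" "h (1, x) = x"
      using h(2)[of 0 A k] h(2)[of 1 A k] p(2)[of A k] s(2)[of A] by simp_all
  qed
  have "homotopic_with (\<lambda>x. True) ?D ?D (s \<circ> p) id"
    using h(1) sp by (subst homotopic_with) (auto intro!: exI[of _ h])
  moreover have "retraction_maps ?D ?G p s"
    unfolding retraction_maps_def
  proof (intro conjI ballI p s)
    fix x assume "x \<in> topspace ?G"
    then obtain A where "A \<in> stiefel2" "x = \<gamma> A" using G by blast
    then show "p (s x) = x" using p(2)[of A 0] s(2) by simp
  qed
  ultimately show ?thesis
    by (rule deformation_retraction_imp_homotopy_equivalent_space)
qed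

theorem corollary3p7:
  fixes n :: nat
  assumes "n \<ge> 1" and "CARD('m::finite) = n + 1"
  shows "conf2 (proj_space :: (complex ^ 'm) set topology) homeomorphic_space
           (open_disc_bundle :: ((complex ^ 2 ^ 'm) \<times> complex) set topology) \<and>
         conf2 (proj_space :: (complex ^ 'm) set topology) homotopy_equivalent_space
           (Gamma_space :: (complex ^ 2 ^ 'm) set topology) \<and>
         conf2 (proj_space :: (quat ^ 'm) set topology) homeomorphic_space
           (open_disc_bundle :: ((quat ^ 2 ^ 'm) \<times> quat) set topology) \<and>
         conf2 (proj_space :: (quat ^ 'm) set topology) homotopy_equivalent_space
           (Gamma_space :: (quat ^ 2 ^ 'm) set topology)"
  by (intro conjI conf2_proj_space_homeomorphic_disc_bundle
      homotopy_eqv_trans[OF homeomorphic_imp_homotopy_equivalent_space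
        [OF conf2_proj_space_homeomorphic_disc_bundle] disc_bundle_homotopy_equivalent_base])

end
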